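(* Let $\delta\in(0,1)$. For a weakly communicating CMDP as described in the context, the finite-horizon-approximation algorithm with span constraints described in the context ensures that with probability at least $1-6\delta$, $$R_T=\tilde{\mathcal O}\big(\mathrm{sp}^\star_r\,S\sqrt{AT}\big)\qquad\text{and}\qquad C_T=\tilde{\mathcal O}\big(\mathrm{sp}^\star_c\,S\sqrt{AT}\big),$$ where these are upper bounds and $\tilde{\mathcal O}$ hides universal constants and factors polylogarithmic in $S,A,T,1/\delta$.
   Context: **Setting.** A constrained MDP (CMDP) is $(\mathcal S,\mathcal A,r,c,\tau,P)$ with finite state space $\mathcal S$ ($|\mathcal S|=S$), finite action space $\mathcal A$ ($|\mathcal A|=A$), reward $r\in[0,1]^{\mathcal S\times\mathcal A}$, cost $c\in[0,1]^{\mathcal S\times\mathcal A}$, threshold $\tau$, and transition function $P=\{P_{s,a}\}$, $P_{s,a}\in\Delta_{\mathcal S}$ (probability simplex over $\mathcal S$). Only $P$ is unknown to the learner. The learner starts at an arbitrary $s_1$; at step $t=1,\dots,T$ it observes $s_t$, plays $a_t$, and $s_{t+1}\sim P_{s_t,a_t}$. The MDP is weakly communicating: $\mathcal S$ splits into two subsets, the first consisting of states transient under every stationary policy, and any two states of the second communicating under some stationary policy. For a stationary policy $\pi:\mathcal S\to\Delta_{\mathcal A}$ and utility $d$, $J^{\pi,d}(s)=\liminf_{T\to\infty}\frac1T\mathbb E[\sum_{t=1}^Td(s_t,a_t)\mid\pi,P,s_1=s]$. The bias function $q^{\pi,d}$ satisfies $q^{\pi,d}(s,a)+J^{\pi,d}(s)=d(s,a)+\sum_{s'}P_{s,a}(s')v^{\pi,d}(s')$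 with $v^{\pi,d}(s)=\sum_a\pi(a|s)q^{\pi,d}(s,a)$, and $J^{\pi,q^{\pi,d}}(s)=0$ for all $s$. $\pi^\star$ is a stationary policy that, for every $s$, maximizes $J^{\pi,r}(s)$ over stationary $\pi$ subject to $J^{\pi,c}(s)\le\tau$, and for which $J^{\pi^\star,r}(s)=J^\star$ and $J^{\pi^\star,c}(s)=J^\star_c$ do not depend on $s$. With $\mathrm{sp}(v)=\max v-\min v$, put $\mathrm{sp}^\star_r=\mathrm{sp}(v^{\pi^\star,r})$, $\mathrm{sp}^\star_c=\mathrm{sp}(v^{\pi^\star,c})$, both known to the learner. $R_T=\sum_{t=1}^T(J^\star-r(s_t,a_t))$, $C_T=\sum_{t=1}^T(c(s_t,a_t)-\tau)$. **Occupancy measures.** For a state $s$ and horizon $H$, $\mathcal V_s$ is the set of $\nu\in[0,1]^{\mathcal S\times\mathcal A\times[H]\times\mathcal S}$ with (1) $\sum_{a,s''}\nu(s',a,1,s'')=\mathbb 1\{s'=s\}$ for all $s'$; (2) $\sum_{s',a,s''}\nu(s',a,h,s'')=1$ for all $h$; (3) $\sum_{s'',a}\nu(s'',a,h,s')=\sum_{a,s''}\nu(s',a,h+1,s'')$ for all $s'$ and $h\in[H-1]$. Write $\nu(s',a,h)=\sum_{s''}\nu(s',a,h,s'')$, $\nu(s',a)=\sum_h\nu(s',a,h)$, $\nu(s',h)=\sum_a\nu(s',a,h)$, $\langle\nu,d\rangle=\sum_{s',a}\nu(s',a)d(s',a)$. The induced policy and transition are $\pi_\nu(a|s',h)=\nu(s',a,h)/\nu(s',h)$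 and $P_{\nu,s',a,h}(s'')=\nu(s',a,h,s'')/\nu(s',a,h)$. For a nonstationary policy $\pi$ and an inhomogeneous transition $P'$, $V^{\pi,P',d}_h(s)=\mathbb E[\sum_{h'=h}^Hd(s_{h'},a_{h'})\mid\pi,P',s_h=s]$, and $V^{\nu,d}_h=V_h^{\pi_\nu,P_\nu,d}$. Where a denominator above vanishes, $\pi_\nu$ and $P_\nu$ are undetermined and the search is also over their values there: the constraints on $(\pi_\nu,P_\nu)$ below mean that they hold simultaneously for some choice, which is then used. **Algorithm.** $H=\sqrt{T/(S^2A)}$, $K=T/H$ (treated as integers). The steps are split into $K$ episodes of length $H$; $s^k_h=s_{(k-1)H+h}$, $a^k_h=a_{(k-1)H+h}$. Let $N_k(s,a)$, $N_k(s,a,s')$ be visit counts before episode $k$, $N^+_k(s,a)=\max\{1,N_k(s,a)\}$, $\bar P_{k,s,a}(s')=N_k(s,a,s')/N^+_k(s,a)$, $\alpha_k(s,a)=\ln(2SAT/\delta)/N_k^+(s,a)$, and let $\mathcal P_k$ be the set of $P'=\{P'_{s,a,h}\}$ with $P'_{s,a,h}\in\Delta_{\mathcal S}$ and $|P'_{s,a,h}(s')-\bar P_{k,s,a}(s')|\le4\sqrt{\bar P_{k,s,a}(s')\alpha_k(s,a)}+28\alpha_k(s,a)$ for all $s,a,h,s'$. Let $\mathcal W_{k,s}=\{\nu\in\mathcal V_s:P_\nu\in\mathcal P_k,\ \mathrm{sp}(V^{\nu,r}_h)\le2\mathrm{sp}^\star_r\text{ and }\mathrm{sp}(V^{\nu,c}_h)\le2\mathrm{sp}^\star_c\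 \forall h\in[H]\}$. In episode $k$, observe $s^k_1$, compute $\nu_k\in\arg\max\{\langle\nu,r\rangle:\nu\in\mathcal W_{k,s^k_1},\ \langle\nu,c\rangle\le H\tau+\mathrm{sp}^\star_c\}$ (arbitrary if infeasible), let $\pi_k=\pi_{\nu_k}$, and for $h=1,\dots,H$ play $a^k_h\sim\pi_k(\cdot|s^k_h,h)$.
   Formalization: The bounds sp*·S·√(AT) are replaced by max(sp*·S·√(AT), √T), because the literal bounds fail when the spans are zero (one state, two actions, r=c=(1,0), τ=1/2, T=2); they are unchanged when sp*·S·√A ≥ 1. States and actions are labelled by naturals. *)

theory Defs
  imports "HOL-Probability.Probability"
begin

section \<open>Constrained Markov decision processes\<close>

record ('s, 'a) cmdp =
  states :: "'s set"
  actions :: "'a set"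
  reward :: "'s \<Rightarrow> 'a \<Rightarrow> real"
  cost :: "'s \<Rightarrow> 'a \<Rightarrow> real"
  threshold :: real
  trans :: "'s \<Rightarrow> 'a \<Rightarrow> 's pmf"

definition cmdp :: "('s, 'a) cmdp \<Rightarrow> bool" where
  "cmdp M \<longleftrightarrow>
     finite (states M) \<and> states M \<noteq> {} \<and> finite (actions M) \<and> actions M \<noteq> {} \<and>
     (\<forall>s\<in>states M. \<forall>a\<in>actions M.
        reward M s a \<in> {0..1} \<and> cost M s a \<in> {0..1} \<and> set_pmf (trans M s a) \<subseteq> states M)"

text \<open>A history is the list of transitions (state, action, next state) made so far.\<close>

type_synonym ('s, 'a) history = "('s \<times> 'a \<times> 's) list"

definition cur_state :: "'s \<Rightarrow> ('s, 'a) history \<Rightarrow> 's" where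
  "cur_state s hist = (if hist = [] then s else snd (snd (last hist)))"

text \<open>
  Law of the first \<open>n\<close> transitions from \<open>s\<close>, for an action rule \<open>\<beta>\<close> and a transition rule \<open>\<kappa>\<close>
  that may depend on the history.
\<close>

primrec rollout ::
    "(('s, 'a) history \<Rightarrow> 's \<Rightarrow> 'a pmf) \<Rightarrow> (('s, 'a) history \<Rightarrow> 's \<Rightarrow> 'a \<Rightarrow> 's pmf) \<Rightarrow>
     nat \<Rightarrow> 's \<Rightarrow> ('s, 'a) history pmf" where
  "rollout \<beta> \<kappa> 0 s = return_pmf []"
| "rollout \<beta> \<kappa> (Suc n) s =
     bind_pmf (rollout \<beta> \<kappa> n s) (\<lambda>hist.
     bind_pmf (\<beta> hist (cur_state s hist)) (\<lambda>a.
     bind_pmf (\<kappa> hist (cur_state s hist) a) (\<lambda>s'.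
       return_pmf (hist @ [(cur_state s hist, a, s')]))))"

definition total :: "('s \<Rightarrow> 'a \<Rightarrow> real) \<Rightarrow> ('s, 'a) history \<Rightarrow> real" where
  "total d hist = (\<Sum>(s, a, s')\<leftarrow>hist. d s a)"

definition span_on :: "'s set \<Rightarrow> ('s \<Rightarrow> real) \<Rightarrow> real" where
  "span_on X v = Max (v ` X) - Min (v ` X)"


section \<open>Stationary policies\<close>

definition stationary_policy :: "('s, 'a) cmdp \<Rightarrow> ('s \<Rightarrow> 'a pmf) \<Rightarrow> bool" where
  "stationary_policy M \<pi> \<longleftrightarrow> (\<forall>s\<in>states M. set_pmf (\<pi> s) \<subseteq> actions M)"

definition stationary_rollout ::
    "('s, 'a) cmdp \<Rightarrow> ('s \<Rightarrow> 'a pmf) \<Rightarrow> nat \<Rightarrow> 's \<Rightarrow> ('s, 'a) history pmf" where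
  "stationary_rollout M \<pi> = rollout (\<lambda>_. \<pi>) (\<lambda>_. trans M)"

definition return_prob :: "('s, 'a) cmdp \<Rightarrow> ('s \<Rightarrow> 'a pmf) \<Rightarrow> 's \<Rightarrow> real" where
  "return_prob M \<pi> s =
     (SUP n. measure_pmf.prob (stationary_rollout M \<pi> n s) {\<omega>. \<exists>x a. (x, a, s) \<in> set \<omega>})"

definition transient_state :: "('s, 'a) cmdp \<Rightarrow> ('s \<Rightarrow> 'a pmf) \<Rightarrow> 's \<Rightarrow> bool" where
  "transient_state M \<pi> s \<longleftrightarrow> return_prob M \<pi> s < 1"

definition accessible :: "('s, 'a) cmdp \<Rightarrow> ('s \<Rightarrow> 'a pmf) \<Rightarrow> 's \<Rightarrow> 's \<Rightarrow> bool" where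
  "accessible M \<pi> s s' \<longleftrightarrow>
     (\<exists>n. measure_pmf.prob (stationary_rollout M \<pi> n s) {\<omega>. cur_state s \<omega> = s'} > 0)"

definition weakly_communicating :: "('s, 'a) cmdp \<Rightarrow> bool" where
  "weakly_communicating M \<longleftrightarrow>
     (\<exists>X Y. X \<union> Y = states M \<and> X \<inter> Y = {} \<and>
        (\<forall>s\<in>X. \<forall>\<pi>. stationary_policy M \<pi> \<longrightarrow> transient_state M \<pi> s) \<and>
        (\<forall>s\<in>Y. \<forall>s'\<in>Y. \<exists>\<pi>. stationary_policy M \<pi> \<and> accessible M \<pi> s s' \<and> accessible M \<pi> s' s))"

definition avg_util ::
    "('s, 'a) cmdp \<Rightarrow> ('s \<Rightarrow> 'a pmf) \<Rightarrow> ('s \<Rightarrow> 'a \<Rightarrow> real) \<Rightarrow> 's \<Rightarrow> real" where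
  "avg_util M \<pi> d s =
     real_of_ereal (liminf (\<lambda>n. ereal
       (measure_pmf.expectation (stationary_rollout M \<pi> n s) (total d) / real n)))"

definition policy_avg ::
    "('s, 'a) cmdp \<Rightarrow> ('s \<Rightarrow> 'a pmf) \<Rightarrow> ('s \<Rightarrow> 'a \<Rightarrow> real) \<Rightarrow> 's \<Rightarrow> real" where
  "policy_avg M \<pi> q s = (\<Sum>a\<in>actions M. pmf (\<pi> s) a * q s a)"

text \<open>
  \<open>is_bias M \<pi> d q\<close> says that \<open>q\<close> is the bias function of \<open>\<pi>\<close> for \<open>d\<close>; the state bias function
  is then \<open>policy_avg M \<pi> q\<close>.
\<close>

definition is_bias ::
    "('s, 'a) cmdp \<Rightarrow> ('s \<Rightarrow> 'a pmf) \<Rightarrow> ('s \<Rightarrow> 'a \<Rightarrow> real) \<Rightarrow> ('s \<Rightarrow> 'a \<Rightarrow> real) \<Rightarrow> bool" where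
  "is_bias M \<pi> d q \<longleftrightarrow>
     (\<forall>s\<in>states M. \<forall>a\<in>actions M.
        q s a + avg_util M \<pi> d s =
        d s a + (\<Sum>s'\<in>states M. pmf (trans M s a) s' * policy_avg M \<pi> q s')) \<and>
     (\<forall>s\<in>states M. avg_util M \<pi> q s = 0)"

definition optimal_policy :: "('s, 'a) cmdp \<Rightarrow> ('s \<Rightarrow> 'a pmf) \<Rightarrow> real \<Rightarrow> real \<Rightarrow> bool" where
  "optimal_policy M \<pi> Jr Jc \<longleftrightarrow>
     stationary_policy M \<pi> \<and>
     (\<forall>s\<in>states M.
        avg_util M \<pi> (cost M) s \<le> threshold M \<and>
        (\<forall>\<pi>'. stationary_policy M \<pi>' \<and> avg_util M \<pi>' (cost M) s \<le> threshold M \<longrightarrow>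
               avg_util M \<pi>' (reward M) s \<le> avg_util M \<pi> (reward M) s)) \<and>
     (\<forall>s\<in>states M. avg_util M \<pi> (reward M) s = Jr \<and> avg_util M \<pi> (cost M) s = Jc)"


section \<open>Finite-horizon policies, transitions and occupancy measures\<close>

text \<open>The step index of the following objects ranges over \<open>{1..H}\<close>.\<close>

type_synonym ('s, 'a) ns_policy = "'s \<Rightarrow> nat \<Rightarrow> 'a pmf"
type_synonym ('s, 'a) ns_trans = "'s \<Rightarrow> 'a \<Rightarrow> nat \<Rightarrow> 's pmf"
type_synonym ('s, 'a) occ = "'s \<Rightarrow> 'a \<Rightarrow> nat \<Rightarrow> 's \<Rightarrow> real"

definition ns_policy :: "('s, 'a) cmdp \<Rightarrow> nat \<Rightarrow> ('s, 'a) ns_policy \<Rightarrow> bool" where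
  "ns_policy M H \<pi> \<longleftrightarrow> (\<forall>s\<in>states M. \<forall>h\<in>{1..H}. set_pmf (\<pi> s h) \<subseteq> actions M)"

definition ns_trans :: "('s, 'a) cmdp \<Rightarrow> nat \<Rightarrow> ('s, 'a) ns_trans \<Rightarrow> bool" where
  "ns_trans M H P \<longleftrightarrow>
     (\<forall>s\<in>states M. \<forall>a\<in>actions M. \<forall>h\<in>{1..H}. set_pmf (P s a h) \<subseteq> states M)"

definition value_fn ::
    "nat \<Rightarrow> ('s, 'a) ns_policy \<Rightarrow> ('s, 'a) ns_trans \<Rightarrow> ('s \<Rightarrow> 'a \<Rightarrow> real) \<Rightarrow> nat \<Rightarrow> 's \<Rightarrow> real" where
  "value_fn H \<pi> P d h s =
     measure_pmf.expectation
       (rollout (\<lambda>hist x. \<pi> x (h + length hist)) (\<lambda>hist x a. P x a (h + length hist)) (Suc H - h) s)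
       (total d)"

definition occ_measures :: "('s, 'a) cmdp \<Rightarrow> nat \<Rightarrow> 's \<Rightarrow> ('s, 'a) occ set" where
  "occ_measures M H s =
     {\<nu>. (\<forall>s'\<in>states M. \<forall>a\<in>actions M. \<forall>h\<in>{1..H}. \<forall>s''\<in>states M. \<nu> s' a h s'' \<in> {0..1}) \<and>
         (\<forall>s'\<in>states M. (\<Sum>a\<in>actions M. \<Sum>s''\<in>states M. \<nu> s' a 1 s'') = of_bool (s' = s)) \<and>
         (\<forall>h\<in>{1..H}. (\<Sum>s'\<in>states M. \<Sum>a\<in>actions M. \<Sum>s''\<in>states M. \<nu> s' a h s'') = 1) \<and>
         (\<forall>s'\<in>states M. \<forall>h\<in>{1..<H}.
            (\<Sum>s''\<in>states M. \<Sum>a\<in>actions M. \<nu> s'' a h s') =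
            (\<Sum>a\<in>actions M. \<Sum>s''\<in>states M. \<nu> s' a (h + 1) s''))}"

definition occ_sah :: "('s, 'a) cmdp \<Rightarrow> ('s, 'a) occ \<Rightarrow> 's \<Rightarrow> 'a \<Rightarrow> nat \<Rightarrow> real" where
  "occ_sah M \<nu> s a h = (\<Sum>s''\<in>states M. \<nu> s a h s'')"

definition occ_sh :: "('s, 'a) cmdp \<Rightarrow> ('s, 'a) occ \<Rightarrow> 's \<Rightarrow> nat \<Rightarrow> real" where
  "occ_sh M \<nu> s h = (\<Sum>a\<in>actions M. occ_sah M \<nu> s a h)"

definition occ_inner ::
    "('s, 'a) cmdp \<Rightarrow> nat \<Rightarrow> ('s, 'a) occ \<Rightarrow> ('s \<Rightarrow> 'a \<Rightarrow> real) \<Rightarrow> real" where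
  "occ_inner M H \<nu> d =
     (\<Sum>s\<in>states M. \<Sum>a\<in>actions M. (\<Sum>h\<in>{1..H}. occ_sah M \<nu> s a h) * d s a)"

text \<open>
  An occupancy measure determines its policy and transition function only where the respective
  marginals do not vanish, so these are relations; elsewhere any distribution is allowed.
\<close>

definition induced_policy ::
    "('s, 'a) cmdp \<Rightarrow> nat \<Rightarrow> ('s, 'a) occ \<Rightarrow> ('s, 'a) ns_policy \<Rightarrow> bool" where
  "induced_policy M H \<nu> \<pi> \<longleftrightarrow> ns_policy M H \<pi> \<and>
     (\<forall>s\<in>states M. \<forall>h\<in>{1..H}. occ_sh M \<nu> s h \<noteq> 0 \<longrightarrow>
        (\<forall>a\<in>actions M. pmf (\<pi> s h) a = occ_sah M \<nu> s a h / occ_sh M \<nu> s h))"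

definition induced_trans ::
    "('s, 'a) cmdp \<Rightarrow> nat \<Rightarrow> ('s, 'a) occ \<Rightarrow> ('s, 'a) ns_trans \<Rightarrow> bool" where
  "induced_trans M H \<nu> P \<longleftrightarrow> ns_trans M H P \<and>
     (\<forall>s\<in>states M. \<forall>a\<in>actions M. \<forall>h\<in>{1..H}. occ_sah M \<nu> s a h \<noteq> 0 \<longrightarrow>
        (\<forall>s''\<in>states M. pmf (P s a h) s'' = \<nu> s a h s'' / occ_sah M \<nu> s a h))"


section \<open>The learning algorithm\<close>

definition visits :: "('s, 'a) history \<Rightarrow> 's \<Rightarrow> 'a \<Rightarrow> nat" where
  "visits hist s a = length (filter (\<lambda>(x, b, y). x = s \<and> b = a) hist)"

definition trans_visits :: "('s, 'a) history \<Rightarrow> 's \<Rightarrow> 'a \<Rightarrow> 's \<Rightarrow> nat" where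
  "trans_visits hist s a s' = length (filter (\<lambda>(x, b, y). x = s \<and> b = a \<and> y = s') hist)"

definition visits_plus :: "('s, 'a) history \<Rightarrow> 's \<Rightarrow> 'a \<Rightarrow> real" where
  "visits_plus hist s a = real (max 1 (visits hist s a))"

definition emp_trans :: "('s, 'a) history \<Rightarrow> 's \<Rightarrow> 'a \<Rightarrow> 's \<Rightarrow> real" where
  "emp_trans hist s a s' = real (trans_visits hist s a s') / visits_plus hist s a"

definition log_term :: "('s, 'a) cmdp \<Rightarrow> nat \<Rightarrow> real \<Rightarrow> real" where
  "log_term M T \<delta> = ln (2 * real (card (states M)) * real (card (actions M)) * real T / \<delta>)"

definition conf_radius :: "('s, 'a) cmdp \<Rightarrow> nat \<Rightarrow> real \<Rightarrow> ('s, 'a) history \<Rightarrow> 's \<Rightarrow> 'a \<Rightarrow> real" where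
  "conf_radius M T \<delta> hist s a = log_term M T \<delta> / visits_plus hist s a"

definition conf_set ::
    "('s, 'a) cmdp \<Rightarrow> nat \<Rightarrow> nat \<Rightarrow> real \<Rightarrow> ('s, 'a) history \<Rightarrow> ('s, 'a) ns_trans set" where
  "conf_set M T H \<delta> hist =
     {P. ns_trans M H P \<and>
         (\<forall>s\<in>states M. \<forall>a\<in>actions M. \<forall>h\<in>{1..H}. \<forall>s'\<in>states M.
            \<bar>pmf (P s a h) s' - emp_trans hist s a s'\<bar>
            \<le> 4 * sqrt (emp_trans hist s a s' * conf_radius M T \<delta> hist s a)
              + 28 * conf_radius M T \<delta> hist s a)}"

text \<open>
  \<open>spr\<close> and \<open>spc\<close> are the spans of the reward and cost bias functions of the optimal policy,
  which are inputs of the learner; \<open>hist\<close> is the history before the episode and \<open>s\<close> the first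
  state of the episode.  A point of the search space carries its choice of \<open>\<pi>\<close> and \<open>P\<close>.
\<close>

definition search_space ::
    "('s, 'a) cmdp \<Rightarrow> nat \<Rightarrow> nat \<Rightarrow> real \<Rightarrow> real \<Rightarrow> real \<Rightarrow> ('s, 'a) history \<Rightarrow> 's \<Rightarrow>
     (('s, 'a) occ \<times> ('s, 'a) ns_policy \<times> ('s, 'a) ns_trans) set" where
  "search_space M T H \<delta> spr spc hist s =
     {(\<nu>, \<pi>, P). \<nu> \<in> occ_measures M H s \<and> induced_policy M H \<nu> \<pi> \<and> induced_trans M H \<nu> P \<and>
        P \<in> conf_set M T H \<delta> hist \<and>
        (\<forall>h\<in>{1..H}. span_on (states M) (value_fn H \<pi> P (reward M) h) \<le> 2 * spr \<and>
                    span_on (states M) (value_fn H \<pi> P (cost M) h) \<le> 2 * spc)}"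

definition feasible_set ::
    "('s, 'a) cmdp \<Rightarrow> nat \<Rightarrow> nat \<Rightarrow> real \<Rightarrow> real \<Rightarrow> real \<Rightarrow> ('s, 'a) history \<Rightarrow> 's \<Rightarrow>
     (('s, 'a) occ \<times> ('s, 'a) ns_policy \<times> ('s, 'a) ns_trans) set" where
  "feasible_set M T H \<delta> spr spc hist s =
     {(\<nu>, \<pi>, P). (\<nu>, \<pi>, P) \<in> search_space M T H \<delta> spr spc hist s \<and>
        occ_inner M H \<nu> (cost M) \<le> real H * threshold M + spc}"

text \<open>
  A planner maps the history before an episode and the first state of the episode to a maximizer.
  Ties are broken arbitrarily, and if the program is infeasible any policy may be returned.
\<close>

type_synonym ('s, 'a) planner =
  "('s, 'a) history \<Rightarrow> 's \<Rightarrow> ('s, 'a) occ \<times> ('s, 'a) ns_policy \<times> ('s, 'a) ns_trans"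

definition valid_planner ::
    "('s, 'a) cmdp \<Rightarrow> nat \<Rightarrow> nat \<Rightarrow> nat \<Rightarrow> real \<Rightarrow> real \<Rightarrow> real \<Rightarrow> ('s, 'a) planner \<Rightarrow> bool" where
  "valid_planner M T H K \<delta> spr spc plan \<longleftrightarrow>
     (\<forall>k\<in>{1..K}. \<forall>hist. \<forall>s\<in>states M.
        length hist = (k - 1) * H \<and> set hist \<subseteq> states M \<times> actions M \<times> states M \<longrightarrow>
        ns_policy M H (fst (snd (plan hist s))) \<and>
        (feasible_set M T H \<delta> spr spc hist s \<noteq> {} \<longrightarrow>
           plan hist s \<in> feasible_set M T H \<delta> spr spc hist s \<and>
           (\<forall>(\<nu>, \<pi>, P)\<in>feasible_set M T H \<delta> spr spc hist s.
              occ_inner M H \<nu> (reward M) \<le> occ_inner M H (fst (plan hist s)) (reward M))))"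

text \<open>
  With \<open>t\<close> transitions made, \<open>t = (k - 1) * H + (h - 1)\<close>, the learner is at step \<open>h\<close> of episode
  \<open>k\<close>, and the planner was called on the first \<open>(k - 1) * H\<close> transitions.
\<close>

definition learner :: "nat \<Rightarrow> ('s, 'a) planner \<Rightarrow> 's \<Rightarrow> ('s, 'a) history \<Rightarrow> 's \<Rightarrow> 'a pmf" where
  "learner H plan s1 hist s =
     (let past = take (length hist div H * H) hist;
          \<pi> = fst (snd (plan past (cur_state s1 past)))
      in \<pi> s (length hist mod H + 1))"

definition learner_run ::
    "('s, 'a) cmdp \<Rightarrow> nat \<Rightarrow> nat \<Rightarrow> ('s, 'a) planner \<Rightarrow> 's \<Rightarrow> ('s, 'a) history pmf" where
  "learner_run M T H plan s1 = rollout (learner H plan s1) (\<lambda>_. trans M) T s1"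

definition regret :: "('s, 'a) cmdp \<Rightarrow> real \<Rightarrow> ('s, 'a) history \<Rightarrow> real" where
  "regret M Jr \<omega> = (\<Sum>(s, a, s')\<leftarrow>\<omega>. Jr - reward M s a)"

definition violation :: "('s, 'a) cmdp \<Rightarrow> ('s, 'a) history \<Rightarrow> real" where
  "violation M \<omega> = (\<Sum>(s, a, s')\<leftarrow>\<omega>. cost M s a - threshold M)"

text \<open>
  The rate \<open>sp S sqrt (A T)\<close>, floored at \<open>sqrt T\<close>.  The floor is inactive for \<open>sp S sqrt A \<ge> 1\<close>.
  For smaller spans it cannot be dropped, because regret and violation are sums of realized
  rewards and costs: with one state and two actions with \<open>r = c = 1\<close> and \<open>r = c = 0\<close> and threshold
  \<open>1/2\<close>, both spans are \<open>0\<close>, and already for \<open>H = 1\<close> and \<open>T = 2\<close> the learner must play a fair coin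
  and has positive regret with probability \<open>1/4\<close>.
\<close>

definition span_rate :: "('s, 'a) cmdp \<Rightarrow> nat \<Rightarrow> real \<Rightarrow> real" where
  "span_rate M T sp =
     max (sp * real (card (states M)) * sqrt (real (card (actions M)) * real T)) (sqrt (real T))"

end

theory Submission
  imports Defs
begin

text \<open>
  The bias equation of the optimal policy gives \<open>\<bar>V - n J\<bar> \<le> sp\<close> for its \<open>n\<close>-step values, so its
  occupancy measure is feasible whenever the true transition function lies in the confidence set.
  Maximality of the planner then gives an optimistic value of at least \<open>H J - sp\<close> per episode, and
  the \<open>K = S sqrt (A T)\<close> episodes lose \<open>K sp\<close> in total.  The cost constraint of the planner plays
  the same role for the violation.  By the Bellman equation of the planned policy, the optimistic
  value of an episode minus its realized utility is a sum of bounded martingale differences (noise)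
  and of terms \<open>(P' - P) V\<close> (drift), where \<open>P'\<close> is the planned transition function.  The noise is
  controlled by an exponential supermartingale; the drift is at most the span of \<open>V\<close> times the
  confidence width, and the widths are summed by counting visits.  Counts are stale within an
  episode, but a pair doubles its count in at most \<open>log T\<close> episodes, which costs
  \<open>S A H log T\<close> steps, and \<open>S A H \<le> K\<close>.
\<close>

section \<open>Rollouts and exponential supermartingales\<close>

text \<open>Two obstacles shape the proof. An exponential supermartingale needs a rate fixed in
  advance, while the best rate for the deviation of an empirical frequency depends on the random
  number of visits; hence one rate is fixed for every possible number \<open>n\<close>, and the
  failure probabilities are added up over \<open>n\<close> as well. Moreover the true chain may
  enter states to which the planned occupancy measure gives no mass, where the marginals determine
  neither policy nor transition function. The Bellman equation, the span bound and the confidence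
  bound are needed there too; they hold because a point of the search space carries its own
  \<open>\<pi>\<close> and \<open>P\<close> at every state. The choice of \<open>H\<close> means
  \<open>H^2 S^2 A = T\<close>, so \<open>K = H S^2 A\<close> is exactly the target rate divided by
  the span. The span constraints keep noise and drift proportional to the spans rather than to
  \<open>H\<close>. The floor \<open>sqrt T\<close> of \<open>span_rate\<close> absorbs the noise of
  the utilities themselves, which remains when a span is 0. Since \<open>L \<ge> 1 / 2\<close>, all
  terms fit under a multiple of \<open>L^2\<close>.\<close>

definition step_pmf ::
    "(('s, 'a) history \<Rightarrow> 's \<Rightarrow> 'a pmf) \<Rightarrow> (('s, 'a) history \<Rightarrow> 's \<Rightarrow> 'a \<Rightarrow> 's pmf) \<Rightarrow>
     's \<Rightarrow> ('s, 'a) history \<Rightarrow> ('s \<times> 'a \<times> 's) pmf" where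
  "step_pmf \<beta> \<kappa> s hist =
     bind_pmf (\<beta> hist (cur_state s hist)) (\<lambda>a.
       map_pmf (\<lambda>s'. (cur_state s hist, a, s')) (\<kappa> hist (cur_state s hist) a))"

lemma rollout_Suc_step:
  "rollout \<beta> \<kappa> (Suc n) s =
     bind_pmf (rollout \<beta> \<kappa> n s) (\<lambda>hist. map_pmf (\<lambda>x. hist @ [x]) (step_pmf \<beta> \<kappa> s hist))"
  by (simp add: step_pmf_def map_bind_pmf map_pmf_comp) (simp add: map_pmf_def)

lemma cur_state_Cons [simp]: "cur_state s ((x, a, s') # hist) = cur_state s' hist"
  by (simp add: cur_state_def)

lemma cur_state_Nil [simp]: "cur_state s [] = s"
  by (simp add: cur_state_def)

lemma cur_state_take_Suc:
  "i < length \<omega> \<Longrightarrow> cur_state s (take (Suc i) \<omega>) = snd (snd (\<omega> ! i))"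
  by (simp add: cur_state_def take_Suc_conv_app_nth)

text \<open>\<open>rollout\<close> grows at the end, as the learner does, but the Bellman recursion
  conditions on the first transition. From then on both rules see that transition prepended to their
  history, which for \<open>value_fn\<close> amounts to raising the step index by one.\<close>

lemma rollout_Suc_front:
  "rollout \<beta> \<kappa> (Suc n) s =
     bind_pmf (\<beta> [] s) (\<lambda>a. bind_pmf (\<kappa> [] s a) (\<lambda>s'.
       map_pmf ((#) (s, a, s'))
         (rollout (\<lambda>hist. \<beta> ((s, a, s') # hist)) (\<lambda>hist. \<kappa> ((s, a, s') # hist)) n s')))"
proof (induction n)
  case 0
  show ?case
    by (simp add: bind_return_pmf)
next
  case (Suc n)
  show ?case
    by (subst rollout.simps(2), subst Suc.IH)
       (simp add: bind_assoc_pmf bind_map_pmf map_bind_pmf bind_return_pmf)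
qed

lemma length_rollout: "\<omega> \<in> set_pmf (rollout \<beta> \<kappa> n s) \<Longrightarrow> length \<omega> = n"
  by (induction n arbitrary: \<omega>) (auto simp: set_bind_pmf)

lemma state_rollout:
  "\<omega> \<in> set_pmf (rollout \<beta> \<kappa> n s) \<Longrightarrow> i < n \<Longrightarrow> fst (\<omega> ! i) = cur_state s (take i \<omega>)"
proof (induction n arbitrary: \<omega>)
  case (Suc n)
  then obtain hist x where h: "hist \<in> set_pmf (rollout \<beta> \<kappa> n s)"
    and x: "x \<in> set_pmf (step_pmf \<beta> \<kappa> s hist)" "\<omega> = hist @ [x]"
    unfolding rollout_Suc_step by auto
  have l: "length hist = n" using length_rollout[OF h] .
  have "fst x = cur_state s hist" using x(1) by (auto simp: step_pmf_def)
  thus ?case using Suc.IH[OF h] Suc.prems(2) x(2) l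
    by (cases "i = n") (auto simp: nth_append less_Suc_eq)
qed simp

lemma cur_state_in:
  "set hist \<subseteq> X \<times> Y \<times> X \<Longrightarrow> s \<in> X \<Longrightarrow> cur_state s hist \<in> X"
  unfolding cur_state_def using last_in_set by fastforce

text \<open>The conditions on the action rule are asked only of short histories inside the model
  because a planner is constrained only on such histories; the induction carries both restrictions
  along.\<close>

lemma set_rollout:
  assumes "\<And>hist x. length hist < n \<Longrightarrow> set hist \<subseteq> X \<times> Y \<times> X \<Longrightarrow> x \<in> X \<Longrightarrow> set_pmf (\<beta> hist x) \<subseteq> Y"
    and "\<And>hist x a. length hist < n \<Longrightarrow> x \<in> X \<Longrightarrow> a \<in> Y \<Longrightarrow> set_pmf (\<kappa> hist x a) \<subseteq> X"
    and "s \<in> X" and "\<omega> \<in> set_pmf (rollout \<beta> \<kappa> n s)"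
  shows "set \<omega> \<subseteq> X \<times> Y \<times> X"
  using assms
proof (induction n arbitrary: \<omega>)
  case (Suc n)
  then obtain hist x where h: "hist \<in> set_pmf (rollout \<beta> \<kappa> n s)"
    and x: "x \<in> set_pmf (step_pmf \<beta> \<kappa> s hist)" "\<omega> = hist @ [x]"
    unfolding rollout_Suc_step by auto
  have l: "length hist = n" using length_rollout[OF h] .
  have hs: "set hist \<subseteq> X \<times> Y \<times> X"
    using Suc.IH[OF Suc.prems(1) Suc.prems(2) Suc.prems(3) h] by simp
  note c = cur_state_in[OF hs Suc.prems(3)]
  have "x \<in> X \<times> Y \<times> X"
    using x(1) c Suc.prems(1)[OF _ hs c] Suc.prems(2)[OF _ c] l by (fastforce simp: step_pmf_def)
  thus ?case using hs x(2) by simp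
qed simp

lemma finite_rollout:
  assumes "finite X" "finite Y"
    and "\<And>hist x. length hist < n \<Longrightarrow> set hist \<subseteq> X \<times> Y \<times> X \<Longrightarrow> x \<in> X \<Longrightarrow> set_pmf (\<beta> hist x) \<subseteq> Y"
    and "\<And>hist x a. length hist < n \<Longrightarrow> x \<in> X \<Longrightarrow> a \<in> Y \<Longrightarrow> set_pmf (\<kappa> hist x a) \<subseteq> X"
    and "s \<in> X"
  shows "finite (set_pmf (rollout \<beta> \<kappa> n s))"
proof (rule finite_subset)
  show "set_pmf (rollout \<beta> \<kappa> n s) \<subseteq> {\<omega>. set \<omega> \<subseteq> X \<times> Y \<times> X \<and> length \<omega> = n}"
  proof
    fix \<omega> assume w: "\<omega> \<in> set_pmf (rollout \<beta> \<kappa> n s)"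
    show "\<omega> \<in> {\<omega>. set \<omega> \<subseteq> X \<times> Y \<times> X \<and> length \<omega> = n}"
      using set_rollout[OF assms(3-5) w] length_rollout[OF w] by simp
  qed
  show "finite {\<omega>. set \<omega> \<subseteq> X \<times> Y \<times> X \<and> length \<omega> = n}"
    using assms by (intro finite_lists_length_eq) auto
qed

lemma exp_supermartingale:
  assumes "\<And>hist. length hist < n \<Longrightarrow> hist \<in> set_pmf (rollout \<beta> \<kappa> (length hist) s) \<Longrightarrow>
      (\<integral>\<^sup>+x. ennreal (exp (g hist x)) \<partial>step_pmf \<beta> \<kappa> s hist) \<le> 1"
  shows "(\<integral>\<^sup>+\<omega>. ennreal (exp (\<Sum>i<n. g (take i \<omega>) (\<omega> ! i))) \<partial>rollout \<beta> \<kappa> n s) \<le> 1"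
  using assms
proof (induction n)
  case (Suc n)
  have "(\<integral>\<^sup>+\<omega>. ennreal (exp (\<Sum>i<Suc n. g (take i \<omega>) (\<omega> ! i))) \<partial>rollout \<beta> \<kappa> (Suc n) s) =
      (\<integral>\<^sup>+hist. (\<integral>\<^sup>+x. ennreal (exp (\<Sum>i<Suc n. g (take i (hist @ [x])) ((hist @ [x]) ! i)))
         \<partial>step_pmf \<beta> \<kappa> s hist) \<partial>rollout \<beta> \<kappa> n s)"
    unfolding rollout_Suc_step by (simp add: nn_integral_bind_pmf nn_integral_map_pmf)
  also have "\<dots> \<le> (\<integral>\<^sup>+hist. ennreal (exp (\<Sum>i<n. g (take i hist) (hist ! i))) \<partial>rollout \<beta> \<kappa> n s)"
  proof (intro nn_integral_mono_AE AE_pmfI)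
    fix hist assume h: "hist \<in> set_pmf (rollout \<beta> \<kappa> n s)"
    have l: "length hist = n" using length_rollout[OF h] .
    have "(\<Sum>i<Suc n. g (take i (hist @ [x])) ((hist @ [x]) ! i)) =
        (\<Sum>i<n. g (take i hist) (hist ! i)) + g hist x" for x
      using l by (simp add: nth_append)
    hence "(\<integral>\<^sup>+x. ennreal (exp (\<Sum>i<Suc n. g (take i (hist @ [x])) ((hist @ [x]) ! i)))
         \<partial>step_pmf \<beta> \<kappa> s hist) =
        (\<integral>\<^sup>+x. ennreal (exp (\<Sum>i<n. g (take i hist) (hist ! i))) * ennreal (exp (g hist x))
          \<partial>step_pmf \<beta> \<kappa> s hist)"
      by (simp only: exp_add ennreal_mult exp_ge_zero)
    also have "\<dots> = ennreal (exp (\<Sum>i<n. g (take i hist) (hist ! i))) *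
        (\<integral>\<^sup>+x. ennreal (exp (g hist x)) \<partial>step_pmf \<beta> \<kappa> s hist)"
      by (simp add: nn_integral_cmult)
    also have "\<dots> \<le> ennreal (exp (\<Sum>i<n. g (take i hist) (hist ! i))) * 1"
      using Suc.prems[of hist] h l by (intro mult_left_mono) auto
    finally show "(\<integral>\<^sup>+x. ennreal (exp (\<Sum>i<Suc n. g (take i (hist @ [x])) ((hist @ [x]) ! i)))
         \<partial>step_pmf \<beta> \<kappa> s hist) \<le> ennreal (exp (\<Sum>i<n. g (take i hist) (hist ! i)))"
      by simp
  qed
  also have "\<dots> \<le> 1"
    by (rule Suc.IH) (use Suc.prems in auto)
  finally show ?case .
qed simp

text \<open>Markov's inequality for the exponential of the sum. Both concentration bounds below, for
  frequencies and for noise, are instances.\<close>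

lemma exp_supermartingale_tail:
  assumes "\<And>hist. length hist < n \<Longrightarrow> hist \<in> set_pmf (rollout \<beta> \<kappa> (length hist) s) \<Longrightarrow>
      (\<integral>\<^sup>+x. ennreal (exp (g hist x)) \<partial>step_pmf \<beta> \<kappa> s hist) \<le> 1"
  shows "measure_pmf.prob (rollout \<beta> \<kappa> n s) {\<omega>. l \<le> (\<Sum>i<n. g (take i \<omega>) (\<omega> ! i))} \<le> exp (- l)"
proof -
  let ?f = "\<lambda>\<omega>. (\<Sum>i<n. g (take i \<omega>) (\<omega> ! i))"
  have "emeasure (rollout \<beta> \<kappa> n s) {\<omega> \<in> UNIV. 1 \<le> ennreal (exp (- l)) * ennreal (exp (?f \<omega>))}
      \<le> ennreal (exp (- l)) * (\<integral>\<^sup>+\<omega>\<in>UNIV. ennreal (exp (?f \<omega>)) \<partial>rollout \<beta> \<kappa> n s)"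
    using nn_integral_Markov_inequality[of "\<lambda>\<omega>. ennreal (exp (?f \<omega>))" UNIV "rollout \<beta> \<kappa> n s" "ennreal (exp (- l))"]
    by simp
  also have "\<dots> \<le> ennreal (exp (- l)) * 1"
    using exp_supermartingale[OF assms] by (intro mult_left_mono) auto
  also have "{\<omega> \<in> UNIV. 1 \<le> ennreal (exp (- l)) * ennreal (exp (?f \<omega>))} = {\<omega>. l \<le> ?f \<omega>}"
  proof -
    have "(1 \<le> ennreal (exp (- l)) * ennreal (exp x)) = (l \<le> x)" for x
    proof -
      have "ennreal (exp (- l)) * ennreal (exp x) = ennreal (exp (x - l))"
        by (simp add: ennreal_mult[symmetric] exp_add[symmetric])
      thus ?thesis by simp
    qed
    thus ?thesis by simp
  qed
  finally show ?thesis
    by (simp add: measure_pmf.emeasure_eq_measure)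
qed

section \<open>Value functions and occupancy measures\<close>

lemma pmf_weighted_le:
  assumes "finite A" "set_pmf p \<subseteq> A" "\<And>x. x \<in> A \<Longrightarrow> f x \<le> (B::real)"
  shows "(\<Sum>x\<in>A. pmf p x * f x) \<le> B"
proof -
  have "(\<Sum>x\<in>A. pmf p x * f x) \<le> (\<Sum>x\<in>A. pmf p x * B)"
    using assms by (intro sum_mono mult_left_mono) auto
  also have "\<dots> = B"
    using sum_pmf_eq_1[OF assms(1,2)] by (simp flip: sum_distrib_right)
  finally show ?thesis .
qed

lemma pmf_weighted_ge:
  assumes "finite A" "set_pmf p \<subseteq> A" "\<And>x. x \<in> A \<Longrightarrow> (B::real) \<le> f x"
  shows "B \<le> (\<Sum>x\<in>A. pmf p x * f x)"
  using pmf_weighted_le[OF assms(1,2), of "\<lambda>x. - f x" "- B"] assms(3)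
  by (simp add: sum_negf)

lemma pmf_weighted_add_const:
  assumes "finite A" "set_pmf p \<subseteq> A"
  shows "(\<Sum>x\<in>A. pmf p x * (f x + (c::real))) = (\<Sum>x\<in>A. pmf p x * f x) + c"
  using sum_pmf_eq_1[OF assms]
  by (simp add: distrib_left sum.distrib flip: sum_distrib_right)

lemma span_on_ge:
  "finite X \<Longrightarrow> x \<in> X \<Longrightarrow> y \<in> X \<Longrightarrow> v x - v y \<le> span_on X v"
  unfolding span_on_def by (intro diff_mono) (auto intro: Max_ge Min_le)

lemma span_on_le:
  assumes "finite X" "X \<noteq> {}" "\<And>x y. x \<in> X \<Longrightarrow> y \<in> X \<Longrightarrow> v x - v y \<le> b"
  shows "span_on X v \<le> b"
proof -
  have "Max (v ` X) \<in> v ` X" "Min (v ` X) \<in> v ` X"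
    using assms by (auto intro!: Max_in Min_in)
  thus ?thesis using assms(3) by (auto simp: span_on_def)
qed

lemma span_on_nonneg: "finite X \<Longrightarrow> X \<noteq> {} \<Longrightarrow> 0 \<le> span_on X v"
  using span_on_ge[of X _ _ v] by (metis diff_self ex_in_conv)

lemma total_Nil [simp]: "total d [] = 0"
  by (simp add: total_def)

lemma total_Cons [simp]: "total d ((s, a, s') # hist) = d s a + total d hist"
  by (simp add: total_def)

lemma value_fn_end [simp]: "value_fn H \<pi> P d (Suc H) s = 0"
  by (simp add: value_fn_def)

lemma value_fn_Suc:
  fixes M :: "('s, 'a) cmdp"
  assumes M: "cmdp M" and pi: "ns_policy M H \<pi>" and P: "ns_trans M H P"
    and s: "s \<in> states M" and h: "h \<in> {1..H}"
  shows "value_fn H \<pi> P d h s =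
    (\<Sum>a\<in>actions M. pmf (\<pi> s h) a *
       (d s a + (\<Sum>s'\<in>states M. pmf (P s a h) s' * value_fn H \<pi> P d (Suc h) s')))"
proof -
  let ?roll = "\<lambda>h. rollout (\<lambda>hist x. \<pi> x (h + length hist)) (\<lambda>hist x a. P x a (h + length hist))"
  have fin: "finite (states M)" "finite (actions M)" using M by (auto simp: cmdp_def)
  have finr: "finite (set_pmf (?roll (Suc h) (H - h) s'))" if "s' \<in> states M" for s'
  proof (rule finite_rollout[OF fin])
    fix hist :: "('s, 'a) history" and x assume l: "length hist < H - h" and x: "x \<in> states M"
    have hH: "Suc h + length hist \<in> {1..H}" using l by simp
    show "set_pmf (\<pi> x (Suc h + length hist)) \<subseteq> actions M"
      using pi x hH unfolding ns_policy_def by blast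
    show "set_pmf (P x a (Suc h + length hist)) \<subseteq> states M" if "a \<in> actions M" for a
      using P x that hH unfolding ns_trans_def by blast
  qed (rule that)
  have sp: "set_pmf (\<pi> s h) \<subseteq> actions M" using pi s h by (auto simp: ns_policy_def)
  have sP: "set_pmf (P s a h) \<subseteq> states M" if "a \<in> actions M" for a
    using P s h that by (auto simp: ns_trans_def)
  have inner: "measure_pmf.expectation
       (map_pmf ((#) (s, a, s')) (?roll (Suc h) (H - h) s')) (total d) =
      d s a + value_fn H \<pi> P d (Suc h) s'" if "s' \<in> states M" for a s'
    using finr[OF that]
    by (simp add: value_fn_def Bochner_Integration.integral_add integrable_measure_pmf_finite)
  have "value_fn H \<pi> P d h s =
     measure_pmf.expectation (\<pi> s h \<bind> (\<lambda>a. P s a h \<bind> (\<lambda>s'.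
       map_pmf ((#) (s, a, s')) (?roll (Suc h) (H - h) s')))) (total d)"
    using h by (simp add: value_fn_def Suc_diff_le rollout_Suc_front del: rollout.simps)
  also have "\<dots> = (\<Sum>a\<in>actions M. pmf (\<pi> s h) a *
      measure_pmf.expectation (P s a h \<bind> (\<lambda>s'.
       map_pmf ((#) (s, a, s')) (?roll (Suc h) (H - h) s'))) (total d))"
    using sP finr finite_subset[OF sP fin(1)]
    by (subst pmf_expectation_bind[OF fin(2) _ sp]) auto
  also have "\<dots> = (\<Sum>a\<in>actions M. pmf (\<pi> s h) a *
      (\<Sum>s'\<in>states M. pmf (P s a h) s' * (d s a + value_fn H \<pi> P d (Suc h) s')))"
  proof (intro sum.cong refl arg_cong2[where f = "(*)"])
    fix a assume a: "a \<in> actions M"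
    have finx: "finite (set_pmf (map_pmf ((#) (s, a, s')) (?roll (Suc h) (H - h) s')))"
      if "s' \<in> states M" for s'
      using finr[OF that] by simp
    show "measure_pmf.expectation (P s a h \<bind> (\<lambda>s'.
       map_pmf ((#) (s, a, s')) (?roll (Suc h) (H - h) s'))) (total d) =
      (\<Sum>s'\<in>states M. pmf (P s a h) s' * (d s a + value_fn H \<pi> P d (Suc h) s'))"
      by (subst pmf_expectation_bind[OF fin(1) _ sP[OF a]], erule finx, unfold real_scaleR_def)
         (intro sum.cong refl arg_cong2[where f = "(*)"] inner)
  qed
  also have "\<dots> = (\<Sum>a\<in>actions M. pmf (\<pi> s h) a *
       (d s a + (\<Sum>s'\<in>states M. pmf (P s a h) s' * value_fn H \<pi> P d (Suc h) s')))"
    by (intro sum.cong refl arg_cong2[where f = "(*)"])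
       (simp only: pmf_weighted_add_const[OF fin(1) sP] add.commute[of "d s _"])
  finally show ?thesis .
qed

section \<open>Occupancy measures and their flow equations\<close>

lemma occ_measures_nonneg:
  "\<nu> \<in> occ_measures M H s \<Longrightarrow> x \<in> states M \<Longrightarrow> a \<in> actions M \<Longrightarrow> h \<in> {1..H} \<Longrightarrow> y \<in> states M \<Longrightarrow>
    0 \<le> \<nu> x a h y"
  by (auto simp: occ_measures_def)

text \<open>Backward induction: the flow constraint makes the \<open>\<nu>\<close>-average of the value function telescope.\<close>

lemma occ_inner_eq_value_fn:
  assumes M: "cmdp M" and nu: "\<nu> \<in> occ_measures M H s"
    and pi: "induced_policy M H \<nu> \<pi>" and P: "induced_trans M H \<nu> P"
    and s: "s \<in> states M" and H: "1 \<le> H"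
  shows "occ_inner M H \<nu> d = value_fn H \<pi> P d 1 s"
proof -
  let ?S = "states M" and ?A = "actions M"
  let ?V = "value_fn H \<pi> P d"
  let ?U = "\<lambda>h. \<Sum>x\<in>?S. occ_sh M \<nu> x h * ?V h x"
  let ?D = "\<lambda>h. \<Sum>x\<in>?S. \<Sum>a\<in>?A. occ_sah M \<nu> x a h * d x a"
  have fin: "finite ?S" "finite ?A" using M by (auto simp: cmdp_def)
  have nn: "0 \<le> \<nu> x a h y" if "x \<in> ?S" "a \<in> ?A" "h \<in> {1..H}" "y \<in> ?S" for x a h y
    using occ_measures_nonneg[OF nu that] .
  have sah: "0 \<le> occ_sah M \<nu> x a h" if "x \<in> ?S" "a \<in> ?A" "h \<in> {1..H}" for x a h
    unfolding occ_sah_def using nn that by (intro sum_nonneg) auto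
  \<comment> \<open>\<open>pol\<close> and \<open>tr\<close> recover the occupancy measure even
    where a marginal vanishes: by nonnegativity its summands vanish as well, so the free values of
    \<open>\<pi>\<close> and \<open>P\<close> have no influence.\<close>
  have pol: "occ_sh M \<nu> x h * pmf (\<pi> x h) a = occ_sah M \<nu> x a h"
    if "x \<in> ?S" "a \<in> ?A" "h \<in> {1..H}" for x a h
  proof (cases "occ_sh M \<nu> x h = 0")
    case True
    hence "occ_sah M \<nu> x a h = 0"
      unfolding occ_sh_def using sum_nonneg_eq_0_iff[of ?A "\<lambda>a. occ_sah M \<nu> x a h"] fin sah that by auto
    thus ?thesis using True by simp
  next
    case False
    thus ?thesis using pi that by (auto simp: induced_policy_def)
  qed
  have tr: "occ_sah M \<nu> x a h * pmf (P x a h) y = \<nu> x a h y"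
    if "x \<in> ?S" "a \<in> ?A" "h \<in> {1..H}" "y \<in> ?S" for x a h y
  proof (cases "occ_sah M \<nu> x a h = 0")
    case True
    hence "\<nu> x a h y = 0"
      unfolding occ_sah_def using sum_nonneg_eq_0_iff[of ?S "\<lambda>y. \<nu> x a h y"] fin nn that by auto
    thus ?thesis using True by simp
  next
    case False
    thus ?thesis using P that by (auto simp: induced_trans_def)
  qed
  have U: "?U h = ?D h + (\<Sum>y\<in>?S. (\<Sum>x\<in>?S. \<Sum>a\<in>?A. \<nu> x a h y) * ?V (Suc h) y)"
    if h: "h \<in> {1..H}" for h
  proof -
    have "?U h = (\<Sum>x\<in>?S. \<Sum>a\<in>?A. occ_sah M \<nu> x a h * d x a + (\<Sum>y\<in>?S. \<nu> x a h y * ?V (Suc h) y))"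
    proof (intro sum.cong refl)
      fix x assume x: "x \<in> ?S"
      have "occ_sh M \<nu> x h * ?V h x = (\<Sum>a\<in>?A. (occ_sh M \<nu> x h * pmf (\<pi> x h) a) *
          (d x a + (\<Sum>y\<in>?S. pmf (P x a h) y * ?V (Suc h) y)))"
        using value_fn_Suc[OF M _ _ x h, of \<pi> P d] pi P
        by (simp add: induced_policy_def induced_trans_def sum_distrib_left mult.assoc)
      also have "\<dots> = (\<Sum>a\<in>?A. occ_sah M \<nu> x a h * d x a + (\<Sum>y\<in>?S. \<nu> x a h y * ?V (Suc h) y))"
        using pol[OF x _ h] tr[OF x _ h]
        by (intro sum.cong refl) (simp add: distrib_left sum_distrib_left mult.assoc[symmetric])
      finally show "occ_sh M \<nu> x h * ?V h x =
        (\<Sum>a\<in>?A. occ_sah M \<nu> x a h * d x a + (\<Sum>y\<in>?S. \<nu> x a h y * ?V (Suc h) y))" .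
    qed
    also have "\<dots> = ?D h + (\<Sum>x\<in>?S. \<Sum>a\<in>?A. \<Sum>y\<in>?S. \<nu> x a h y * ?V (Suc h) y)"
      by (simp add: sum.distrib)
    also have "(\<Sum>x\<in>?S. \<Sum>a\<in>?A. \<Sum>y\<in>?S. \<nu> x a h y * ?V (Suc h) y) =
        (\<Sum>x\<in>?S. \<Sum>y\<in>?S. \<Sum>a\<in>?A. \<nu> x a h y * ?V (Suc h) y)"
      by (intro sum.cong refl sum.swap)
    also have "\<dots> = (\<Sum>y\<in>?S. \<Sum>x\<in>?S. \<Sum>a\<in>?A. \<nu> x a h y * ?V (Suc h) y)"
      by (rule sum.swap)
    finally show ?thesis by (simp add: sum_distrib_right)
  qed
  have step: "?U h = ?D h + ?U (Suc h)" if h: "h \<in> {1..<H}" for h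
  proof -
    have "(\<Sum>x\<in>?S. \<Sum>a\<in>?A. \<nu> x a h y) = occ_sh M \<nu> y (Suc h)" if "y \<in> ?S" for y
      using nu h that by (simp add: occ_measures_def occ_sh_def occ_sah_def)
    thus ?thesis using U[of h] h by simp
  qed
  \<comment> \<open>The flow constraint ends at \<open>H\<close>; the last step uses instead that
    the value function vanishes at \<open>Suc H\<close>.\<close>
  have last: "?U H = ?D H"
    using U[of H] H by simp
  have "?U (Suc H - n) = (\<Sum>h\<in>{Suc H - n..H}. ?D h)" if "1 \<le> n" "n \<le> H" for n
    using that
  proof (induction n rule: nat_induct_at_least)
    case base
    show ?case using last by simp
  next
    case (Suc n)
    have "?U (H - n) = ?D (H - n) + ?U (Suc (H - n))"
      using Suc by (intro step) auto
    also have "Suc (H - n) = Suc H - n" using Suc by simp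
    also have "?U (Suc H - n) = (\<Sum>h\<in>{Suc H - n..H}. ?D h)"
      using Suc by simp
    also have "?D (H - n) + (\<Sum>h\<in>{Suc H - n..H}. ?D h) = (\<Sum>h\<in>{H - n..H}. ?D h)"
      using Suc by (simp add: sum.atLeast_Suc_atMost[of "H - n"] Suc_diff_le)
    finally show ?case by simp
  qed
  from this[of H] H have "?U 1 = (\<Sum>h\<in>{1..H}. ?D h)" by simp
  also have "\<dots> = occ_inner M H \<nu> d"
    unfolding occ_inner_def sum_distrib_right
    by (subst sum.swap, intro sum.cong refl sum.swap)
  finally have "occ_inner M H \<nu> d = ?U 1" ..
  also have "\<dots> = (\<Sum>x\<in>?S. of_bool (x = s) * ?V 1 x)"
    using nu by (intro sum.cong refl) (auto simp: occ_measures_def occ_sh_def occ_sah_def)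
  also have "\<dots> = ?V 1 s"
    using fin s by (simp add: of_bool_def if_distrib if_distribR sum.delta cong: if_cong)
  finally show ?thesis .
qed

section \<open>Stationary policies over a finite horizon\<close>

primrec state_dist :: "('s, 'a) cmdp \<Rightarrow> ('s \<Rightarrow> 'a pmf) \<Rightarrow> 's \<Rightarrow> nat \<Rightarrow> 's \<Rightarrow> real" where
  "state_dist M \<pi> s 0 y = of_bool (y = s)"
| "state_dist M \<pi> s (Suc n) y =
     (\<Sum>x\<in>states M. \<Sum>a\<in>actions M. state_dist M \<pi> s n x * pmf (\<pi> x) a * pmf (trans M x a) y)"

text \<open>The witness is the law of state, action and next state under \<open>\<pi>\<close> and
  the true transition function. The shift \<open>h - 1\<close> reconciles steps counted from 1 with
  \<open>state_dist\<close>, whose recursion is the flow constraint itself.\<close>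

lemma stationary_occ_measure:
  assumes M: "cmdp M" and pi: "stationary_policy M \<pi>" and s: "s \<in> states M"
  shows "\<exists>\<nu>\<in>occ_measures M H s. induced_policy M H \<nu> (\<lambda>x _. \<pi> x) \<and>
    induced_trans M H \<nu> (\<lambda>x a _. trans M x a)"
proof -
  let ?S = "states M" and ?A = "actions M"
  define \<mu> where "\<mu> = state_dist M \<pi> s"
  define \<nu> where "\<nu> = (\<lambda>x a h y. \<mu> (h - 1) x * pmf (\<pi> x) a * pmf (trans M x a) y)"
  have fin: "finite ?S" "finite ?A" using M by (auto simp: cmdp_def)
  have sp: "(\<Sum>a\<in>?A. pmf (\<pi> x) a) = 1" if "x \<in> ?S" for x
    using pi that fin by (intro sum_pmf_eq_1) (auto simp: stationary_policy_def)
  have sP: "(\<Sum>y\<in>?S. pmf (trans M x a) y) = 1" if "x \<in> ?S" "a \<in> ?A" for x a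
    using M that fin by (intro sum_pmf_eq_1) (auto simp: cmdp_def)
  have nn: "0 \<le> \<mu> n x" for n x
    by (induction n arbitrary: x) (auto simp: \<mu>_def intro!: sum_nonneg mult_nonneg_nonneg)
  have sah: "occ_sah M \<nu> x a h = \<mu> (h - 1) x * pmf (\<pi> x) a" if "x \<in> ?S" "a \<in> ?A" for x a h
    using sP[OF that] by (simp add: occ_sah_def \<nu>_def flip: sum_distrib_left)
  have sh: "occ_sh M \<nu> x h = \<mu> (h - 1) x" if "x \<in> ?S" for x h
    using sp[OF that] sah[OF that] by (simp add: occ_sh_def flip: sum_distrib_left)
  have one: "(\<Sum>x\<in>?S. \<mu> n x) = 1" for n
  proof (induction n)
    case 0
    show ?case using s fin by (simp add: \<mu>_def of_bool_def)
  next
    case (Suc n)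
    have "(\<Sum>y\<in>?S. \<mu> (Suc n) y) = (\<Sum>x\<in>?S. \<Sum>y\<in>?S. \<Sum>a\<in>?A. \<nu> x a (Suc n) y)"
      unfolding \<nu>_def by (simp add: \<mu>_def, subst sum.swap) simp
    also have "\<dots> = (\<Sum>x\<in>?S. occ_sh M \<nu> x (Suc n))"
      unfolding occ_sh_def occ_sah_def by (intro sum.cong refl sum.swap)
    also have "\<dots> = 1" using Suc sh by simp
    finally show ?case .
  qed
  have le1: "\<mu> n x \<le> 1" if "x \<in> ?S" for n x
    using member_le_sum[of x ?S "\<mu> n"] that nn fin one by simp
  have "\<nu> \<in> occ_measures M H s"
    unfolding occ_measures_def
  proof (intro CollectI conjI ballI)
    fix x a h y assume "x \<in> ?S" "a \<in> ?A" "y \<in> ?S"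
    thus "\<nu> x a h y \<in> {0..1}"
      using nn le1[of x] by (auto simp: \<nu>_def pmf_le_1 intro!: mult_nonneg_nonneg mult_le_one)
  next
    fix x assume "x \<in> ?S"
    thus "(\<Sum>a\<in>?A. \<Sum>y\<in>?S. \<nu> x a 1 y) = of_bool (x = s)"
      using sh[of x 1] by (simp add: occ_sh_def occ_sah_def \<mu>_def)
  next
    fix h
    show "(\<Sum>x\<in>?S. \<Sum>a\<in>?A. \<Sum>y\<in>?S. \<nu> x a h y) = 1"
      using sh[of _ h] one[of "h - 1"] by (simp add: occ_sh_def occ_sah_def)
  next
    fix x h assume x: "x \<in> ?S" and h: "h \<in> {1..<H}"
    have "(\<Sum>y\<in>?S. \<Sum>a\<in>?A. \<nu> y a h x) = \<mu> (Suc (h - 1)) x"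
      by (simp add: \<mu>_def \<nu>_def)
    also have "\<dots> = occ_sh M \<nu> x (h + 1)" using sh[OF x, of "h + 1"] h by simp
    finally show "(\<Sum>y\<in>?S. \<Sum>a\<in>?A. \<nu> y a h x) = (\<Sum>a\<in>?A. \<Sum>y\<in>?S. \<nu> x a (h + 1) y)"
      by (simp add: occ_sh_def occ_sah_def)
  qed
  moreover have "induced_policy M H \<nu> (\<lambda>x _. \<pi> x)"
    using pi sah sh by (auto simp: induced_policy_def ns_policy_def stationary_policy_def)
  moreover have "induced_trans M H \<nu> (\<lambda>x a _. trans M x a)"
    using M sah by (auto simp: induced_trans_def ns_trans_def cmdp_def \<nu>_def)
  ultimately show ?thesis by blast
qed

text \<open>By the bias equation a Bellman backup sends \<open>v + c\<close> to
  \<open>v + J + c\<close> (this is \<open>avg\<close>), and backups are monotone. The terminal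
  value 0 lies between \<open>v - Max v\<close> and \<open>v - Min v\<close>, so \<open>n\<close>
  backups give both bounds.\<close>

lemma stationary_value_fn_bounds:
  assumes M: "cmdp M" and pi: "stationary_policy M \<pi>"
    and J: "\<And>s. s \<in> states M \<Longrightarrow> avg_util M \<pi> d s = J"
    and q: "is_bias M \<pi> d q" and s: "s \<in> states M"
    and h: "h \<in> {1..Suc H}"
  defines "v \<equiv> policy_avg M \<pi> q"
  defines "V \<equiv> value_fn H (\<lambda>x _. \<pi> x) (\<lambda>x a _. trans M x a) d"
  shows "real (Suc H - h) * J + v s - Max (v ` states M) \<le> V h s"
    and "V h s \<le> real (Suc H - h) * J + v s - Min (v ` states M)"
proof -
  let ?S = "states M" and ?A = "actions M"
  have fin: "finite ?S" "finite ?A" using M by (auto simp: cmdp_def)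
  have sp: "set_pmf (\<pi> x) \<subseteq> ?A" if "x \<in> ?S" for x
    using pi that by (auto simp: stationary_policy_def)
  have sP: "set_pmf (trans M x a) \<subseteq> ?S" if "x \<in> ?S" "a \<in> ?A" for x a
    using M that by (auto simp: cmdp_def)
  have avg: "(\<Sum>a\<in>?A. pmf (\<pi> x) a * (d x a + (\<Sum>y\<in>?S. pmf (trans M x a) y * (v y + c)))) = v x + J + c"
    if x: "x \<in> ?S" for x c
  proof -
    have "(\<Sum>a\<in>?A. pmf (\<pi> x) a * (d x a + (\<Sum>y\<in>?S. pmf (trans M x a) y * (v y + c)))) =
        (\<Sum>a\<in>?A. pmf (\<pi> x) a * (q x a + (J + c)))"
    proof (intro sum.cong refl arg_cong2[where f = "(*)"])
      fix a assume a: "a \<in> ?A"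
      have "q x a + J = d x a + (\<Sum>y\<in>?S. pmf (trans M x a) y * v y)"
        using q x a J by (simp add: is_bias_def v_def)
      thus "d x a + (\<Sum>y\<in>?S. pmf (trans M x a) y * (v y + c)) = q x a + (J + c)"
        using pmf_weighted_add_const[OF fin(1) sP[OF x a], of v c] by simp
    qed
    also have "\<dots> = v x + J + c"
      using pmf_weighted_add_const[OF fin(2) sp[OF x]] by (simp add: v_def policy_avg_def)
    finally show ?thesis .
  qed
  have "real n * J + v s - Max (v ` ?S) \<le> V (Suc H - n) s \<and>
      V (Suc H - n) s \<le> real n * J + v s - Min (v ` ?S)" if "n \<le> H" for n
    using that s
  proof (induction n arbitrary: s)
    case 0
    thus ?case using fin by (simp add: V_def)
  next
    case (Suc n)
    let ?h = "H - n"
    have V: "V ?h s = (\<Sum>a\<in>?A. pmf (\<pi> s) a * (d s a + (\<Sum>y\<in>?S. pmf (trans M s a) y * V (Suc ?h) y)))"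
      unfolding V_def using Suc.prems pi M
      by (intro value_fn_Suc) (auto simp: ns_policy_def ns_trans_def stationary_policy_def cmdp_def)
    have e: "Suc ?h = Suc H - n" using Suc.prems by simp
    have "v s + J + (real n * J - Max (v ` ?S)) \<le> V ?h s"
      unfolding V avg[OF Suc.prems(2), symmetric]
      using Suc.IH Suc.prems unfolding e
      by (intro sum_mono mult_left_mono add_left_mono) (auto simp: algebra_simps)
    moreover have "V ?h s \<le> v s + J + (real n * J - Min (v ` ?S))"
      unfolding V avg[OF Suc.prems(2), symmetric]
      using Suc.IH Suc.prems unfolding e
      by (intro sum_mono mult_left_mono add_left_mono) (auto simp: algebra_simps)
    ultimately show ?case by (simp add: algebra_simps)
  qed
  from this[of "Suc H - h"] h
  show "real (Suc H - h) * J + v s - Max (v ` states M) \<le> V h s"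
    and "V h s \<le> real (Suc H - h) * J + v s - Min (v ` states M)" by auto
qed

text \<open>Each value is within one span of \<open>n J\<close>, so comparing two states costs two
  spans. This is the origin of the factor 2 in \<open>search_space\<close>.\<close>

lemma stationary_value_fn_span:
  assumes M: "cmdp M" and pi: "stationary_policy M \<pi>"
    and J: "\<And>s. s \<in> states M \<Longrightarrow> avg_util M \<pi> d s = J"
    and q: "is_bias M \<pi> d q" and h: "h \<in> {1..Suc H}"
  defines "sp \<equiv> span_on (states M) (policy_avg M \<pi> q)"
  defines "V \<equiv> value_fn H (\<lambda>x _. \<pi> x) (\<lambda>x a _. trans M x a) d"
  shows "s \<in> states M \<Longrightarrow> \<bar>V h s - real (Suc H - h) * J\<bar> \<le> sp"
    and "span_on (states M) (V h) \<le> 2 * sp"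
proof -
  have fin: "finite (states M)" "states M \<noteq> {}" using M by (auto simp: cmdp_def)
  show *: "\<bar>V h s - real (Suc H - h) * J\<bar> \<le> sp" if s: "s \<in> states M" for s
  proof -
    have "Min (policy_avg M \<pi> q ` states M) \<le> policy_avg M \<pi> q s"
      "policy_avg M \<pi> q s \<le> Max (policy_avg M \<pi> q ` states M)"
      using fin s by auto
    thus ?thesis
      using stationary_value_fn_bounds[OF M pi J q s h]
      by (simp add: V_def sp_def span_on_def abs_le_iff)
  qed
  show "span_on (states M) (V h) \<le> 2 * sp"
  proof (rule span_on_le[OF fin])
    fix x y assume "x \<in> states M" "y \<in> states M"
    thus "V h x - V h y \<le> 2 * sp" using *[of x] *[of y] by (simp add: abs_le_iff)
  qed
qed

section \<open>Concentration of the empirical transition function\<close>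

lemma exp_le_quadratic:
  fixes x :: real
  assumes "\<bar>x\<bar> \<le> 1"
  shows "exp x \<le> 1 + x + x\<^sup>2"
proof (cases "x \<ge> 0")
  case True
  thus ?thesis using assms by (intro exp_bound) auto
next
  case False
  define y where "y = - x"
  have y: "0 \<le> y" using False by (simp add: y_def)
  \<comment> \<open>\<open>(1 - y + y^2) (1 + y) = 1 + y^3\<close> is at least 1, and
    \<open>1 + y\<close> is at most \<open>exp y\<close>; so \<open>1 - y + y^2\<close> dominates
    the reciprocal of \<open>exp y\<close>.\<close>
  have "1 \<le> 1 + y ^ 3" using y by simp
  also have "\<dots> = (1 - y + y\<^sup>2) * (1 + y)" by (simp add: algebra_simps power2_eq_square power3_eq_cube)
  also have "\<dots> \<le> (1 - y + y\<^sup>2) * exp y"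
  proof (rule mult_left_mono)
    have "0 \<le> (1 - y)\<^sup>2 + y" using y by simp
    thus "0 \<le> 1 - y + y\<^sup>2" using y by (simp add: power2_diff)
  qed (simp add: exp_ge_add_one_self)
  finally have "exp (- y) \<le> 1 - y + y\<^sup>2"
    by (simp add: exp_minus field_simps)
  thus ?thesis by (simp add: y_def)
qed

lemma half_le_ln2: "1 / 2 \<le> ln (2 :: real)"
proof -
  have "exp (1 / 2 :: real) \<le> 2"
    using exp_le_quadratic[of "1 / 2"] by (simp add: power2_eq_square)
  thus ?thesis by (subst ln_ge_iff) auto
qed

text \<open>The exponent keeps the factor \<open>p\<close>, which bounds the Bernoulli variance
  \<open>p (1 - p)\<close>. Hoeffding's lemma would lose it, and with it the square root of the
  frequency in the radius.\<close>

lemma bernoulli_mgf_le: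
  fixes p l :: real
  assumes p: "0 \<le> p" "p \<le> 1" and l: "\<bar>l\<bar> \<le> 1"
  shows "exp (l * (1 - p)) * p + exp (l * (0 - p)) * (1 - p) \<le> exp (p * l\<^sup>2)"
proof -
  have b: "\<bar>l * (1 - p)\<bar> \<le> 1" "\<bar>l * (0 - p)\<bar> \<le> 1"
    using assms by (auto simp: abs_mult intro!: mult_le_one)
  have "exp (l * (1 - p)) * p + exp (l * (0 - p)) * (1 - p) \<le>
      (1 + l * (1 - p) + (l * (1 - p))\<^sup>2) * p + (1 + l * (0 - p) + (l * (0 - p))\<^sup>2) * (1 - p)"
    using p by (intro add_mono mult_right_mono exp_le_quadratic b) auto
  also have "\<dots> = 1 + p * l\<^sup>2 * (1 - p)"
    by (simp add: algebra_simps power2_eq_square)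
  also have "\<dots> \<le> 1 + p * l\<^sup>2"
    using p by (simp add: mult_left_le)
  also have "\<dots> \<le> exp (p * l\<^sup>2)" by (rule exp_ge_add_one_self)
  finally show ?thesis .
qed

lemma nn_integral_pmf_point:
  assumes "0 \<le> c" "0 \<le> c'"
  shows "(\<integral>\<^sup>+x. ennreal (if x = y then c else c') \<partial>measure_pmf q) = ennreal (c * pmf q y + c' * (1 - pmf q y))"
proof -
  have "(\<integral>\<^sup>+x. ennreal (if x = y then c else c') \<partial>measure_pmf q) =
      (\<integral>\<^sup>+x. ennreal c * indicator {y} x + ennreal c' * indicator (- {y}) x \<partial>measure_pmf q)"
    by (intro nn_integral_cong) (auto simp: indicator_def)
  also have "\<dots> = ennreal c * emeasure (measure_pmf q) {y} + ennreal c' * emeasure (measure_pmf q) (- {y})"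
    by (subst nn_integral_add) (auto simp: nn_integral_cmult)
  also have "emeasure (measure_pmf q) (- {y}) = ennreal (1 - pmf q y)"
    using measure_pmf.prob_compl[of "{y}" q]
    by (simp add: measure_pmf.emeasure_eq_measure measure_pmf_single Compl_eq_Diff_UNIV)
  also have "emeasure (measure_pmf q) {y} = ennreal (pmf q y)"
    by (simp add: emeasure_pmf_single)
  finally show ?thesis
    using assms by (simp add: ennreal_mult ennreal_plus pmf_le_1)
qed

lemma length_filter_take:
  "t \<le> length xs \<Longrightarrow> real (length (filter P (take t xs))) = (\<Sum>i<t. of_bool (P (xs ! i)))"
  by (induction t) (auto simp: take_Suc_conv_app_nth)

lemma visits_le_length: "visits hist s a \<le> length hist"
  by (simp add: visits_def)

lemma trans_visits_le_visits: "trans_visits hist s a s' \<le> visits hist s a"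
  by (induction hist) (auto simp: visits_def trans_visits_def)

text \<open>Increments \<open>l (1 - p)\<close> or \<open>- l p\<close> are collected only at visits
  of \<open>(x, a)\<close> before time \<open>t\<close>, each reduced by the bound
  \<open>p l^2\<close> on its logarithmic moment. The number of visits may thus be random although
  \<open>l\<close> is not. Either sign of \<open>l\<close> is allowed, which covers both
  tails.\<close>

lemma transition_deviation_tail:
  fixes l c :: real
  assumes l: "\<bar>l\<bar> \<le> 1" and t: "t \<le> T"
  shows "measure_pmf.prob (rollout \<beta> (\<lambda>_. \<kappa>) T s)
     {\<omega> \<in> set_pmf (rollout \<beta> (\<lambda>_. \<kappa>) T s).
        l\<^sup>2 * pmf (\<kappa> x a) y * real (visits (take t \<omega>) x a) + c \<le>
        l * (real (trans_visits (take t \<omega>) x a y) - pmf (\<kappa> x a) y * real (visits (take t \<omega>) x a))}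
    \<le> exp (- c)"
proof -
  let ?R = "rollout \<beta> (\<lambda>_. \<kappa>) T s"
  define p where "p = pmf (\<kappa> x a) y"
  have p: "0 \<le> p" "p \<le> 1" by (auto simp: p_def pmf_le_1)
  define g where "g = (\<lambda>hist :: ('a, 'b) history. \<lambda>z. if length hist < t \<and> fst z = x \<and> fst (snd z) = a
      then l * (of_bool (snd (snd z) = y) - p) - p * l\<^sup>2 else 0)"
  have step: "(\<integral>\<^sup>+z. ennreal (exp (g hist z)) \<partial>step_pmf \<beta> (\<lambda>_. \<kappa>) s hist) \<le> 1" for hist
  proof -
    have inner: "(\<integral>\<^sup>+y'. ennreal (exp (g hist (u, b, y'))) \<partial>\<kappa> u b) \<le> 1" for u b
    proof (cases "length hist < t \<and> u = x \<and> b = a")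
      case True
      have "(\<integral>\<^sup>+y'. ennreal (exp (g hist (u, b, y'))) \<partial>\<kappa> u b) =
        (\<integral>\<^sup>+y'. ennreal (if y' = y then exp (l * (1 - p) - p * l\<^sup>2) else exp (l * (0 - p) - p * l\<^sup>2)) \<partial>\<kappa> x a)"
        unfolding conjunct1[OF conjunct2[OF True]] conjunct2[OF conjunct2[OF True]]
        using True by (auto intro!: nn_integral_cong simp: g_def)
      also have "\<dots> = ennreal (exp (l * (1 - p) - p * l\<^sup>2) * p + exp (l * (0 - p) - p * l\<^sup>2) * (1 - p))"
        by (subst nn_integral_pmf_point) (auto simp: p_def)
      also have "exp (l * (1 - p) - p * l\<^sup>2) * p + exp (l * (0 - p) - p * l\<^sup>2) * (1 - p) =
          (exp (l * (1 - p)) * p + exp (l * (0 - p)) * (1 - p)) / exp (p * l\<^sup>2)"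
        by (simp only: exp_diff add_divide_distrib times_divide_eq_left)
      also have "ennreal \<dots> \<le> ennreal 1"
        using bernoulli_mgf_le[OF p l] by (intro ennreal_leI) simp
      finally show ?thesis by simp
    next
      case False
      thus ?thesis by (auto simp: g_def)
    qed
    have "(\<integral>\<^sup>+z. ennreal (exp (g hist z)) \<partial>step_pmf \<beta> (\<lambda>_. \<kappa>) s hist) \<le>
        (\<integral>\<^sup>+b. 1 \<partial>\<beta> hist (cur_state s hist))"
      unfolding step_pmf_def
      by (simp only: nn_integral_bind_pmf nn_integral_map_pmf) (intro nn_integral_mono inner)
    thus ?thesis by simp
  qed
  have "measure_pmf.prob ?R {\<omega> \<in> set_pmf ?R.
        l\<^sup>2 * p * real (visits (take t \<omega>) x a) + c \<le>
        l * (real (trans_visits (take t \<omega>) x a y) - p * real (visits (take t \<omega>) x a))}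
    \<le> measure_pmf.prob ?R {\<omega>. c \<le> (\<Sum>i<T. g (take i \<omega>) (\<omega> ! i))}"
  proof (rule measure_pmf.finite_measure_mono)
    have "(\<Sum>i<T. g (take i \<omega>) (\<omega> ! i)) = l * (real (trans_visits (take t \<omega>) x a y) -
        p * real (visits (take t \<omega>) x a)) - l\<^sup>2 * p * real (visits (take t \<omega>) x a)"
      if w: "\<omega> \<in> set_pmf ?R" for \<omega>
    proof -
      have len: "length \<omega> = T" using length_rollout[OF w] .
      have "(\<Sum>i<T. g (take i \<omega>) (\<omega> ! i)) = (\<Sum>i<t. g (take i \<omega>) (\<omega> ! i))"
        using t len by (intro sum.mono_neutral_right) (auto simp: g_def)
      also have "\<dots> = (\<Sum>i<t. l * (of_bool (case \<omega> ! i of (x', b, y') \<Rightarrow> x' = x \<and> b = a \<and> y' = y)) -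
          (l * p + p * l\<^sup>2) * of_bool (case \<omega> ! i of (x', b, y') \<Rightarrow> x' = x \<and> b = a))"
        using t len by (intro sum.cong refl) (auto simp: g_def algebra_simps split: prod.splits)
      also have "\<dots> = l * real (trans_visits (take t \<omega>) x a y) - (l * p + p * l\<^sup>2) * real (visits (take t \<omega>) x a)"
        using t len
        by (simp add: sum_subtractf visits_def trans_visits_def length_filter_take flip: sum_distrib_left)
      finally show ?thesis by (simp add: algebra_simps)
    qed
    thus "{\<omega> \<in> set_pmf ?R.
        l\<^sup>2 * p * real (visits (take t \<omega>) x a) + c \<le>
        l * (real (trans_visits (take t \<omega>) x a y) - p * real (visits (take t \<omega>) x a))}
      \<subseteq> {\<omega>. c \<le> (\<Sum>i<T. g (take i \<omega>) (\<omega> ! i))}"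
      by auto
  qed simp
  also have "\<dots> \<le> exp (- c)"
    by (rule exp_supermartingale_tail) (rule step)
  finally show ?thesis by (simp only: p_def)
qed

text \<open>The minimizer over \<open>l\<close> of \<open>l p n + 2 L / l\<close>, the deviation
  that rate \<open>l\<close> permits at \<open>n\<close> visits, capped at 1 because
  \<open>bernoulli_mgf_le\<close> needs \<open>\<bar>l\<bar> \<le> 1\<close>.\<close>

definition deviation_rate :: "real \<Rightarrow> real \<Rightarrow> real \<Rightarrow> real" where
  "deviation_rate L n p = (if n * p \<le> 2 * L then 1 else sqrt (2 * L / (n * p)))"

text \<open>
  Bernstein's bound with the variance proxy \<open>p\<close> replaced by its estimate \<open>m / n\<close>, by solving
  the quadratic inequality \<open>u\<^sup>2 \<le> 8 \<alpha> (m / n + u)\<close> for the error \<open>u\<close>.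
\<close>

lemma empirical_bernstein_radius:
  fixes L n p m :: real
  assumes L: "0 < L" and n: "1 \<le> n" and p: "0 \<le> p" and m: "0 \<le> m"
    and dev: "deviation_rate L n p * \<bar>m - p * n\<bar> < (deviation_rate L n p)\<^sup>2 * p * n + 2 * L"
  shows "\<bar>p - m / n\<bar> \<le> 4 * sqrt (m / n * (L / n)) + 28 * (L / n)"
proof -
  define u where "u = \<bar>p - m / n\<bar>"
  define \<alpha> where "\<alpha> = L / n"
  have a: "0 < \<alpha>" using L n by (simp add: \<alpha>_def)
  have un: "u * n = \<bar>m - p * n\<bar>"
    using n by (simp add: u_def abs_mult_pos' algebra_simps abs_minus_commute)
  have q: "0 \<le> m / n" using m n by simp
  have sq: "0 \<le> sqrt (m / n * \<alpha>)" by (intro real_sqrt_ge_zero mult_nonneg_nonneg) (use a q in auto)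
  show ?thesis
  proof (cases "n * p \<le> 2 * L")
    case True
    hence "u * n < 4 * L" using dev un by (simp add: deviation_rate_def mult.commute)
    hence "u < 4 * \<alpha>" using n by (simp add: \<alpha>_def field_simps)
    hence "u \<le> 4 * sqrt (m / n * \<alpha>) + 28 * \<alpha>" using sq a by linarith
    thus ?thesis by (simp add: u_def \<alpha>_def)
  next
    case False
    define l where "l = sqrt (2 * L / (n * p))"
    have np: "0 < n * p" using False L by simp
    have l: "0 < l" "l\<^sup>2 * (n * p) = 2 * L" using np L n p by (auto simp: l_def)
    have "deviation_rate L n p = l" using False by (simp add: deviation_rate_def l_def)
    hence "l * (u * n) < l\<^sup>2 * (n * p) + 2 * L"
      using dev unfolding un by (simp add: ac_simps)
    hence "l * (u * n) < 4 * L" unfolding l(2) by simp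
    hence "(l * (u * n))\<^sup>2 \<le> (4 * L)\<^sup>2"
      using l n by (intro power_mono) (auto simp: u_def)
    \<comment> \<open>The factor \<open>p\<close> completes \<open>l^2 (n p)\<close>, which the
      choice of \<open>l\<close> makes equal to \<open>2 L\<close>.\<close>
    hence "p * (l * (u * n))\<^sup>2 \<le> p * (4 * L)\<^sup>2"
      using p by (rule mult_left_mono)
    hence "(l\<^sup>2 * (n * p)) * (u\<^sup>2 * n) \<le> 16 * L\<^sup>2 * p"
      by (simp add: power_mult_distrib power2_eq_square ac_simps)
    hence "(2 * L) * (u\<^sup>2 * n) \<le> (2 * L) * (8 * L * p)"
      unfolding l(2) by (simp add: power2_eq_square)
    hence "u\<^sup>2 * n \<le> 8 * L * p" by (rule mult_left_le_imp_le) (use L in simp)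
    hence "u\<^sup>2 \<le> 8 * \<alpha> * p" using n by (simp add: \<alpha>_def field_simps)
    also have "\<dots> \<le> 8 * \<alpha> * (m / n + u)"
      using a by (intro mult_left_mono) (auto simp: u_def)
    finally have u2: "u\<^sup>2 \<le> 8 * \<alpha> * (m / n + u)" .
    have "u \<le> 4 * sqrt (m / n * \<alpha>) + 28 * \<alpha>"
    proof (rule ccontr)
      \<comment> \<open>A larger \<open>u\<close> would give
        \<open>u^2 > 16 (m / n) \<alpha> + 28 \<alpha> u\<close>, whereas \<open>u2\<close> allows
        only the coefficients 8 and 8.\<close>
      assume "\<not> ?thesis"
      hence c: "4 * sqrt (m / n * \<alpha>) + 28 * \<alpha> < u" by simp
      have u0: "0 < u" using c sq a by linarith
      have "16 * (m / n * \<alpha>) = 4 * sqrt (m / n * \<alpha>) * (4 * sqrt (m / n * \<alpha>))"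
      proof -
        have "0 \<le> m / n * \<alpha>" using a q by (intro mult_nonneg_nonneg) auto
        hence "m / n * \<alpha> = sqrt (m / n * \<alpha>) * sqrt (m / n * \<alpha>)"
          by (simp only: real_sqrt_mult_self abs_of_nonneg)
        moreover have "16 * x = 4 * w * (4 * w)" if "x = w * w" for x w :: real using that by simp
        ultimately show ?thesis by blast
      qed
      also have "\<dots> \<le> 4 * sqrt (m / n * \<alpha>) * u"
        using c sq a by (intro mult_left_mono) auto
      finally have "16 * (m / n * \<alpha>) + 28 * \<alpha> * u \<le> (4 * sqrt (m / n * \<alpha>) + 28 * \<alpha>) * u"
        by (simp add: algebra_simps)
      also have "\<dots> < u * u" using c u0 by simp
      finally have "16 * (m / n * \<alpha>) + 28 * \<alpha> * u < 8 * \<alpha> * (m / n + u)"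
        using u2 by (simp add: power2_eq_square)
      moreover have "8 * \<alpha> * (m / n + u) = 8 * (m / n * \<alpha>) + 8 * (\<alpha> * u)"
        by (simp add: algebra_simps)
      moreover have "0 \<le> m / n * \<alpha>" "0 \<le> \<alpha> * u"
        by (rule mult_nonneg_nonneg, use a q u0 in simp, use a q u0 in simp)+
      ultimately show False by linarith
    qed
    thus ?thesis by (simp add: u_def \<alpha>_def)
  qed
qed

text \<open>The first bound replaces logarithms of \<open>T\<close> by \<open>L\<close>; the second
  lets constants and single factors \<open>L\<close> be absorbed into \<open>L^2\<close>.\<close>

lemma log_term_ge_ln2:
  assumes "cmdp M" and \<delta>: "0 < \<delta>" "\<delta> < 1" and "0 < T"
  shows "ln (2 * real T) \<le> log_term M T \<delta>" "1 / 2 \<le> log_term M T \<delta>"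
proof -
  have S: "1 \<le> real (card (states M))" "1 \<le> real (card (actions M))"
    using assms(1) by (auto simp: cmdp_def Suc_le_eq card_gt_0_iff)
  have "1 * 1 \<le> real (card (states M)) * real (card (actions M))"
    by (intro mult_mono S) auto
  hence "2 * real T * 1 \<le> 2 * real T * (real (card (states M)) * real (card (actions M)))"
    by (intro mult_left_mono) auto
  also have "\<dots> \<le> 2 * real T * (real (card (states M)) * real (card (actions M))) / \<delta>"
    using \<delta>(1,2) by (intro order_trans[OF _ divide_left_mono[of \<delta> 1]]) auto
  finally have "2 * real T \<le> 2 * real (card (states M)) * real (card (actions M)) * real T / \<delta>"
    by (simp add: ac_simps)
  thus *: "ln (2 * real T) \<le> log_term M T \<delta>"
    unfolding log_term_def using assms by (subst ln_le_cancel_iff) (auto intro: less_le_trans[of 0 "2 * real T"])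
  have "1 / 2 \<le> ln (2 :: real)" by (rule half_le_ln2)
  also have "ln (2::real) \<le> ln (2 * real T)" using assms by simp
  finally show "1 / 2 \<le> log_term M T \<delta>" using * by simp
qed

lemma exp_neg_log_term:
  assumes "cmdp M" "0 < \<delta>" "0 < T"
  shows "exp (- log_term M T \<delta>) = \<delta> / (2 * real (card (states M)) * real (card (actions M)) * real T)"
proof -
  have S: "0 < real (card (states M))" "0 < real (card (actions M))"
    using assms(1) by (auto simp: cmdp_def card_gt_0_iff)
  thus ?thesis using assms
    by (simp add: log_term_def exp_minus)
qed

text \<open>Union bound over the time, the value \<open>n\<close> of the count, the triple and the
  sign; one of the enumerated rates matches the actual count. The exponent is \<open>2 L\<close>
  rather than \<open>L\<close> because \<open>(2 S A T)^2\<close> has to pay for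
  \<open>2 T^2 S^2 A\<close> events; what remains is \<open>\<delta>^2 / (2 A)\<close>.\<close>

lemma prob_conf_set:
  fixes M :: "('s, 'a) cmdp" and \<beta> :: "('s, 'a) history \<Rightarrow> 's \<Rightarrow> 'a pmf" and s :: 's
  assumes M: "cmdp M" and \<delta>: "0 < \<delta>" "\<delta> < 1" and T: "0 < T"
  defines "R \<equiv> rollout \<beta> (\<lambda>_. trans M) T s"
  shows "measure_pmf.prob R {\<omega>. \<not> (\<forall>t<T. (\<lambda>x a h. trans M x a) \<in> conf_set M T H \<delta> (take t \<omega>))} \<le> \<delta>"
proof -
  let ?S = "states M" and ?A = "actions M"
  define L where "L = log_term M T \<delta>"
  have L: "1 / 2 \<le> L" unfolding L_def by (rule log_term_ge_ln2) fact+
  have fin: "finite ?S" "finite ?A" and card: "0 < card ?S" "0 < card ?A"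
    using M by (auto simp: cmdp_def card_gt_0_iff)
  define E where "E = (\<lambda>\<sigma> (t, n, x, a, y). {\<omega> \<in> set_pmf R.
     (let l = \<sigma> * deviation_rate L (real n) (pmf (trans M x a) y) in
        l\<^sup>2 * pmf (trans M x a) y * real (visits (take t \<omega>) x a) + 2 * L \<le>
        l * (real (trans_visits (take t \<omega>) x a y) - pmf (trans M x a) y * real (visits (take t \<omega>) x a)))})"
  define I where "I = {..<T} \<times> {1..T} \<times> ?S \<times> ?A \<times> ?S"
  have rate: "0 < deviation_rate L n p" "deviation_rate L n p \<le> 1" for n p
    using L by (auto simp: deviation_rate_def)
  have PE: "measure_pmf.prob R (E \<sigma> i) \<le> exp (- (2 * L))" if "i \<in> I" "\<sigma> \<in> {1, -1}" for i \<sigma>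
  proof -
    obtain t n x a y where i: "i = (t, n, x, a, y)" by (cases i) auto
    show ?thesis unfolding i E_def Let_def R_def prod.case
      by (rule transition_deviation_tail)
         (use that rate[of "real n" "pmf (trans M x a) y"] in \<open>auto simp: i I_def abs_mult\<close>)
  qed
  have sub: "{\<omega>. \<not> (\<forall>t<T. (\<lambda>x a h. trans M x a) \<in> conf_set M T H \<delta> (take t \<omega>))} \<inter> set_pmf R
      \<subseteq> (\<Union>i\<in>I. E 1 i) \<union> (\<Union>i\<in>I. E (-1) i)"
  proof
    fix \<omega> assume "\<omega> \<in> {\<omega>. \<not> (\<forall>t<T. (\<lambda>x a h. trans M x a) \<in> conf_set M T H \<delta> (take t \<omega>))} \<inter> set_pmf R"
    then obtain t where w: "\<omega> \<in> set_pmf R" and t: "t < T"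
      and nc: "(\<lambda>x a h. trans M x a) \<notin> conf_set M T H \<delta> (take t \<omega>)" by blast
    have len: "length \<omega> = T" using length_rollout[OF w[unfolded R_def]] .
    have "ns_trans M H (\<lambda>x a h. trans M x a)" using M by (auto simp: ns_trans_def cmdp_def)
    then obtain x a y where xay: "x \<in> ?S" "a \<in> ?A" "y \<in> ?S" and
      viol: "\<not> \<bar>pmf (trans M x a) y - emp_trans (take t \<omega>) x a y\<bar>
            \<le> 4 * sqrt (emp_trans (take t \<omega>) x a y * conf_radius M T \<delta> (take t \<omega>) x a)
              + 28 * conf_radius M T \<delta> (take t \<omega>) x a"
      using nc unfolding conf_set_def mem_Collect_eq by blast
    define n where "n = visits (take t \<omega>) x a"
    define m where "m = trans_visits (take t \<omega>) x a y"
    define p where "p = pmf (trans M x a) y"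
    have p: "0 \<le> p" "p \<le> 1" by (auto simp: p_def pmf_le_1)
    have mn: "m \<le> n"
      unfolding n_def m_def by (rule trans_visits_le_visits)
    \<comment> \<open>Without visits the empirical frequency is 0 and the radius is
      \<open>28 L \<ge> 14\<close>, which no probability can violate.\<close>
    have n1: "1 \<le> n"
    proof (rule ccontr)
      assume "\<not> 1 \<le> n"
      hence "n = 0" "m = 0" using mn by auto
      thus False using viol p L
        by (simp add: emp_trans_def conf_radius_def visits_plus_def n_def[symmetric] m_def[symmetric]
            p_def[symmetric] L_def[symmetric])
    qed
    have nT: "n \<le> T"
      using visits_le_length[of "take t \<omega>" x a] t len by (simp add: n_def)
    have "\<not> \<bar>p - real m / real n\<bar> \<le> 4 * sqrt (real m / real n * (L / real n)) + 28 * (L / real n)"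
      using viol n1 by (simp add: emp_trans_def conf_radius_def visits_plus_def n_def[symmetric]
          m_def[symmetric] p_def[symmetric] L_def[symmetric])
    hence "\<not> deviation_rate L n p * \<bar>m - p * n\<bar> < (deviation_rate L n p)\<^sup>2 * p * n + 2 * L"
      using empirical_bernstein_radius[of L "real n" p "real m"] L n1 p(1) by linarith
    hence "deviation_rate L n p * (m - p * n) \<ge> (deviation_rate L n p)\<^sup>2 * p * n + 2 * L \<or>
        - deviation_rate L n p * (m - p * n) \<ge> (deviation_rate L n p)\<^sup>2 * p * n + 2 * L"
      by (cases "0 \<le> real m - p * n") (simp_all add: right_diff_distrib)
    hence "\<omega> \<in> E 1 (t, n, x, a, y) \<or> \<omega> \<in> E (-1) (t, n, x, a, y)"
      using w unfolding E_def by (simp add: Let_def n_def[symmetric] m_def[symmetric] p_def[symmetric])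
    moreover have "(t, n, x, a, y) \<in> I" using t n1 nT xay by (simp add: I_def)
    ultimately show "\<omega> \<in> (\<Union>i\<in>I. E 1 i) \<union> (\<Union>i\<in>I. E (-1) i)" by blast
  qed
  have finI: "finite I" using fin by (simp add: I_def)
  have U: "measure_pmf.prob R (\<Union>i\<in>I. E \<sigma> i) \<le> real (card I) * exp (- (2 * L))" if "\<sigma> \<in> {1, -1}" for \<sigma>
  proof -
    have "measure_pmf.prob R (\<Union>i\<in>I. E \<sigma> i) \<le> (\<Sum>i\<in>I. measure_pmf.prob R (E \<sigma> i))"
      by (rule measure_pmf.finite_measure_subadditive_finite[OF finI]) auto
    also have "\<dots> \<le> (\<Sum>i\<in>I. exp (- (2 * L)))" by (intro sum_mono PE that)
    finally show ?thesis by simp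
  qed
  have "measure_pmf.prob R {\<omega>. \<not> (\<forall>t<T. (\<lambda>x a h. trans M x a) \<in> conf_set M T H \<delta> (take t \<omega>))} =
      measure_pmf.prob R ({\<omega>. \<not> (\<forall>t<T. (\<lambda>x a h. trans M x a) \<in> conf_set M T H \<delta> (take t \<omega>))} \<inter> set_pmf R)"
    by (rule measure_Int_set_pmf[symmetric])
  also have "\<dots> \<le> measure_pmf.prob R ((\<Union>i\<in>I. E 1 i) \<union> (\<Union>i\<in>I. E (-1) i))"
    by (rule measure_pmf.finite_measure_mono[OF sub]) simp
  also have "\<dots> \<le> measure_pmf.prob R (\<Union>i\<in>I. E 1 i) + measure_pmf.prob R (\<Union>i\<in>I. E (-1) i)"
    by (rule measure_Un_le) auto
  also have "\<dots> \<le> real (card I) * exp (- (2 * L)) + real (card I) * exp (- (2 * L))"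
    by (intro add_mono U) auto
  also have "exp (- (2 * L)) = (\<delta> / (2 * real (card ?S) * real (card ?A) * real T))\<^sup>2"
    using exp_neg_log_term[OF M \<delta>(1) T] exp_of_nat_mult[of 2 "- L"] by (simp add: L_def)
  also have "card I = T * (T * (card ?S * (card ?A * card ?S)))"
    by (simp add: I_def card_cartesian_product)
  also have "real \<dots> * (\<delta> / (2 * real (card ?S) * real (card ?A) * real T))\<^sup>2 +
      real \<dots> * (\<delta> / (2 * real (card ?S) * real (card ?A) * real T))\<^sup>2 = \<delta> * (\<delta> / (2 * real (card ?A)))"
    using card T by (simp add: field_simps power2_eq_square)
  also have "\<dots> \<le> \<delta>"
  proof -
    have "1 \<le> real (card ?A)" using card by simp
    hence "\<delta> / (2 * real (card ?A)) \<le> 1" using \<delta> by (simp add: field_simps)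
    thus ?thesis using \<delta> by (intro mult_left_le) auto
  qed
  finally show ?thesis .
qed

section \<open>Summing over stale visit counts\<close>

definition occurrences :: "(nat \<Rightarrow> 'b) \<Rightarrow> 'b \<Rightarrow> nat \<Rightarrow> nat" where
  "occurrences z x t = card {j. j < t \<and> z j = x}"

lemma occurrences_0 [simp]: "occurrences z x 0 = 0"
  by (simp add: occurrences_def)

lemma occurrences_Suc: "occurrences z x (Suc t) = occurrences z x t + of_bool (z t = x)"
proof -
  have "{j. j < Suc t \<and> z j = x} = {j. j < t \<and> z j = x} \<union> (if z t = x then {t} else {})"
    by (auto simp: less_Suc_eq)
  moreover have "t \<notin> {j. j < t \<and> z j = x}" by simp
  ultimately show ?thesis by (simp add: occurrences_def)
qed

lemma occurrences_mono: "s \<le> t \<Longrightarrow> occurrences z x s \<le> occurrences z x t"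
  unfolding occurrences_def by (rule card_mono) auto

lemma occurrences_le: "occurrences z x t \<le> t"
  by (induction t) (auto simp: occurrences_Suc)

text \<open>The factor 3 comes from comparing \<open>1 / max 1 n\<close> with
  \<open>1 / (n + 2)\<close>, where \<open>n = 1\<close> is the worst case.\<close>

lemma inverse_occurrence_le_ln_diff: "1 / real (max 1 n) \<le> 3 * (ln (real n + 2) - ln (real n + 1))"
proof -
  have "ln (1 + - (1 / (real n + 2))) \<le> - (1 / (real n + 2))"
    by (rule ln_add_one_self_le_self2) (simp add: field_simps)
  also have "1 + - (1 / (real n + 2)) = (real n + 1) / (real n + 2)"
    by (simp add: field_simps)
  finally have "1 / (real n + 2) \<le> ln (real n + 2) - ln (real n + 1)"
    by (simp add: ln_div)
  hence "3 * (1 / (real n + 2)) \<le> 3 * (ln (real n + 2) - ln (real n + 1))"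
    by (rule mult_left_mono) simp
  moreover have "1 / real (max 1 n) \<le> 3 * (1 / (real n + 2))"
    by (cases n) (auto simp: field_simps)
  ultimately show ?thesis by (rule order_trans[rotated])
qed

text \<open>The sum of \<open>3 ln (count + 1)\<close> over \<open>X\<close> is a potential: each
  step raises it by at least its own summand, and no count exceeds \<open>n\<close> at the
  end.\<close>

lemma sum_inverse_occurrences:
  assumes X: "finite X" "\<And>i. i < n \<Longrightarrow> z i \<in> X"
  shows "(\<Sum>i<n. 1 / real (max 1 (occurrences z (z i) i))) \<le> 3 * real (card X) * ln (real n + 1)"
proof -
  have *: "m \<le> n \<Longrightarrow> (\<Sum>i<m. 1 / real (max 1 (occurrences z (z i) i)))
      \<le> (\<Sum>x\<in>X. 3 * ln (real (occurrences z x m) + 1))" for m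
  proof (induction m)
    case (Suc m)
    have zm: "z m \<in> X" using X Suc.prems by simp
    have "(\<Sum>i<Suc m. 1 / real (max 1 (occurrences z (z i) i)))
        \<le> (\<Sum>x\<in>X. 3 * ln (real (occurrences z x m) + 1)) + 1 / real (max 1 (occurrences z (z m) m))"
      using Suc by simp
    also have "\<dots> \<le> (\<Sum>x\<in>X. 3 * ln (real (occurrences z x m) + 1)) +
       (\<Sum>x\<in>X. if x = z m then 3 * (ln (real (occurrences z x m) + 2) - ln (real (occurrences z x m) + 1)) else 0)"
      using X(1) zm inverse_occurrence_le_ln_diff[of "occurrences z (z m) m"] by simp
    also have "\<dots> = (\<Sum>x\<in>X. 3 * ln (real (occurrences z x (Suc m)) + 1))"
      unfolding sum.distrib[symmetric]
      by (intro sum.cong refl) (auto simp: occurrences_Suc add.commute)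
    finally show ?case .
  qed simp
  also have "(\<Sum>x\<in>X. 3 * ln (real (occurrences z x n) + 1)) \<le> (\<Sum>x\<in>X. 3 * ln (real n + 1))"
    using occurrences_le[of z _ n] by (intro sum_mono) simp
  finally show ?thesis by simp
qed

text \<open>
  Within a block of length \<open>H\<close> the counts used by the algorithm are stale.  A step is bad if the
  current count exceeds twice the stale one; a block containing such a step doubles the count.
\<close>

lemma card_doubling_steps:
  fixes z :: "nat \<Rightarrow> 'b" and H K :: nat
  assumes X: "finite X" "\<And>i. i < K * H \<Longrightarrow> z i \<in> X" and KH: "0 < K * H"
  defines "B \<equiv> {i. i < K * H \<and> 2 * max 1 (occurrences z (z i) (i div H * H)) < occurrences z (z i) i}"
  shows "real (card B) \<le> real (card X) * real H * log 2 (real (K * H))"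
proof -
  define Bx where "Bx = (\<lambda>x k. {i. i < k * H \<and> z i = x \<and>
      2 * max 1 (occurrences z x (i div H * H)) < occurrences z x i})"
  have finB: "finite (Bx x k)" for x k by (rule finite_subset[of _ "{..<k * H}"]) (auto simp: Bx_def)
  have H: "0 < H" using KH by simp
  \<comment> \<open>For each \<open>x\<close> the logarithm of its count at block boundaries pays
    for the bad steps: a block adds at most \<open>H\<close> of them, and only if the logarithm
    rises by at least 1. The \<open>max 1\<close> makes the logarithm start at 0.\<close>
  have *: "real (card (Bx x k)) \<le> real H * log 2 (real (max 1 (occurrences z x (k * H))))" for x k
  proof (induction k)
    case 0
    show ?case by (simp add: Bx_def)
  next
    case (Suc k)
    let ?N = "max 1 (occurrences z x (k * H))" and ?N' = "max 1 (occurrences z x (Suc k * H))"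
    have mono: "?N \<le> ?N'"
      using occurrences_mono[of "k * H" "Suc k * H" z x] by (auto simp: max_def)
    define D where "D = Bx x (Suc k) - Bx x k"
    have D: "D \<subseteq> {k * H..<Suc k * H}" by (auto simp: D_def Bx_def not_less)
    have cD: "card D \<le> H" using card_mono[OF _ D] by simp
    have "Bx x k \<subseteq> Bx x (Suc k)" by (auto simp: Bx_def)
    hence c: "card (Bx x (Suc k)) = card (Bx x k) + card D"
      using finB card_Diff_subset[of "Bx x k" "Bx x (Suc k)"] card_mono[of "Bx x (Suc k)" "Bx x k"]
      by (simp add: D_def)
    show ?case
    proof (cases "D = {}")
      case True
      have "log 2 (real ?N) \<le> log 2 (real ?N')" using mono by simp
      hence "real H * log 2 (real ?N) \<le> real H * log 2 (real ?N')"
        by (intro mult_left_mono) auto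
      thus ?thesis using Suc.IH c True by simp
    next
      case False
      then obtain i where i: "i \<in> D" by blast
      have "i div H = k" using D i H
        by (metis atLeastLessThan_iff div_nat_eqI mult.commute subsetD)
      hence "2 * ?N < occurrences z x i" using i by (auto simp: D_def Bx_def)
      also have "\<dots> \<le> occurrences z x (Suc k * H)" using D i by (intro occurrences_mono) auto
      finally have "2 * ?N \<le> ?N'" by simp
      hence "2 * real ?N \<le> real ?N'" by linarith
      hence "log 2 (2 * real ?N) \<le> log 2 (real ?N')" by (rule log_mono[rotated 2]) simp_all
      moreover have "log 2 (2 * real ?N) = 1 + log 2 (real ?N)" by (subst log_mult) auto
      ultimately have "1 + log 2 (real ?N) \<le> log 2 (real ?N')" by linarith
      hence "real H * (1 + log 2 (real ?N)) \<le> real H * log 2 (real ?N')"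
        by (rule mult_left_mono) simp
      thus ?thesis using Suc.IH c cD by (simp add: distrib_left)
    qed
  qed
  have "B \<subseteq> (\<Union>x\<in>X. Bx x K)" using X(2) by (auto simp: B_def Bx_def)
  hence "card B \<le> card (\<Union>x\<in>X. Bx x K)"
    by (rule card_mono[rotated]) (use X(1) finB in simp)
  also have "\<dots> \<le> (\<Sum>x\<in>X. card (Bx x K))" by (rule card_UN_le[OF X(1)])
  finally have "real (card B) \<le> (\<Sum>x\<in>X. real (card (Bx x K)))"
    by (simp flip: of_nat_sum)
  also have "\<dots> \<le> (\<Sum>x\<in>X. real H * log 2 (real (K * H)))"
  proof (rule sum_mono)
    fix x
    have "max 1 (occurrences z x (K * H)) \<le> K * H" using KH occurrences_le[of z x "K * H"] by simp
    hence "log 2 (real (max 1 (occurrences z x (K * H)))) \<le> log 2 (real (K * H))"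
      by (subst log_le_cancel_iff) (auto simp del: of_nat_mult)
    hence "real H * log 2 (real (max 1 (occurrences z x (K * H)))) \<le> real H * log 2 (real (K * H))"
      by (rule mult_left_mono) simp
    thus "real (card (Bx x K)) \<le> real H * log 2 (real (K * H))"
      by (rule order_trans[OF *])
  qed
  finally show ?thesis by simp
qed

text \<open>Bad steps are charged the crude bound \<open>b\<close>. At all others the stale inverse
  count is at most twice the current one, so current counts can be summed: \<open>W\<close> is twice
  the bound of \<open>sum_inverse_occurrences\<close>, and Cauchy-Schwarz produces the square root
  term.\<close>

lemma sum_stale_rate_le:
  fixes z :: "nat \<Rightarrow> 'b" and H K :: nat and f :: "nat \<Rightarrow> real"
  assumes X: "finite X" "\<And>i. i < K * H \<Longrightarrow> z i \<in> X" and KH: "0 < K * H"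
    and b: "0 \<le> b" "0 \<le> c" "0 \<le> c'"
    and f: "\<And>i. i < K * H \<Longrightarrow> f i \<le> b"
      "\<And>i. i < K * H \<Longrightarrow> f i \<le> c * sqrt (1 / real (max 1 (occurrences z (z i) (i div H * H))))
          + c' * (1 / real (max 1 (occurrences z (z i) (i div H * H))))"
  defines "W \<equiv> 6 * real (card X) * ln (real (K * H) + 1)"
  shows "(\<Sum>i<K * H. f i) \<le> b * (real (card X) * real H * log 2 (real (K * H)))
      + c * sqrt (real (K * H) * W) + c' * W"
proof -
  define u where "u = (\<lambda>i. 1 / real (max 1 (occurrences z (z i) (i div H * H))))"
  define w where "w = (\<lambda>i. 1 / real (max 1 (occurrences z (z i) i)))"
  define B where "B = {i. i < K * H \<and> 2 * max 1 (occurrences z (z i) (i div H * H)) < occurrences z (z i) i}"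
  have w0: "0 \<le> w i" for i by (simp add: w_def)
  have finB: "finite B" by (rule finite_subset[of _ "{..<K * H}"]) (auto simp: B_def)
  have good: "u i \<le> 2 * w i" if "i < K * H" "i \<notin> B" for i
  proof -
    have "max 1 (occurrences z (z i) i) \<le> 2 * max 1 (occurrences z (z i) (i div H * H))"
      using that by (auto simp: B_def)
    hence "real (max 1 (occurrences z (z i) i)) \<le> 2 * real (max 1 (occurrences z (z i) (i div H * H)))"
      by linarith
    thus ?thesis unfolding u_def w_def by (simp add: field_simps del: of_nat_max)
  qed
  have fi: "f i \<le> (if i \<in> B then b else 0) + (c * sqrt (2 * w i) + c' * (2 * w i))" if "i < K * H" for i
  proof (cases "i \<in> B")
    case True
    have "0 \<le> c * sqrt (2 * w i) + c' * (2 * w i)"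
      using b w0[of i] by (intro add_nonneg_nonneg mult_nonneg_nonneg) auto
    thus ?thesis using f(1)[OF that] True by simp
  next
    case False
    have "f i \<le> c * sqrt (u i) + c' * u i" using f(2)[OF that] by (simp add: u_def)
    also have "\<dots> \<le> c * sqrt (2 * w i) + c' * (2 * w i)"
      using good[OF that False] b by (intro add_mono mult_left_mono) auto
    finally show ?thesis using False by simp
  qed
  have "(\<Sum>i<K * H. w i) \<le> 3 * real (card X) * ln (real (K * H) + 1)"
    unfolding w_def by (rule sum_inverse_occurrences[OF X])
  hence W: "(\<Sum>i<K * H. 2 * w i) \<le> W"
    unfolding W_def sum_distrib_left[symmetric] by linarith
  have "(\<Sum>i<K * H. 1 * sqrt (2 * w i))\<^sup>2 \<le> (\<Sum>i<K * H. 1\<^sup>2) * (\<Sum>i<K * H. (sqrt (2 * w i))\<^sup>2)"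
    by (rule Cauchy_Schwarz_ineq_sum)
  also have "\<dots> = real (K * H) * (\<Sum>i<K * H. 2 * w i)"
    using w0 by simp
  also have "\<dots> \<le> real (K * H) * W" by (intro mult_left_mono W) simp
  finally have sq: "(\<Sum>i<K * H. sqrt (2 * w i)) \<le> sqrt (real (K * H) * W)"
    by (simp add: real_le_rsqrt)
  have "(\<Sum>i<K * H. f i) \<le> (\<Sum>i<K * H. (if i \<in> B then b else 0) + (c * sqrt (2 * w i) + c' * (2 * w i)))"
    by (intro sum_mono fi) simp
  also have "\<dots> = (\<Sum>i<K * H. if i \<in> B then b else 0) + (c * (\<Sum>i<K * H. sqrt (2 * w i)) + c' * (\<Sum>i<K * H. 2 * w i))"
    by (simp add: sum.distrib sum_distrib_left)
  also have "(\<Sum>i<K * H. if i \<in> B then b else 0) = b * real (card B)"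
  proof -
    have "{i \<in> {..<K * H}. i \<in> B} = B" by (auto simp: B_def)
    thus ?thesis by (simp flip: sum.inter_filter)
  qed
  also have "b * real (card B) + (c * (\<Sum>i<K * H. sqrt (2 * w i)) + c' * (\<Sum>i<K * H. 2 * w i)) \<le>
     b * (real (card X) * real H * log 2 (real (K * H))) + (c * sqrt (real (K * H) * W) + c' * W)"
    using card_doubling_steps[OF X KH] b sq W
    by (intro add_mono mult_left_mono) (auto simp: B_def)
  finally show ?thesis by simp
qed

section \<open>Martingale noise and confidence widths\<close>

lemma pmf_hoeffding:
  fixes f :: "'b \<Rightarrow> real"
  assumes b: "\<And>x. x \<in> set_pmf p \<Longrightarrow> \<bar>f x\<bar> \<le> b"
    and E: "measure_pmf.expectation p f = 0" and l: "0 < l"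
  shows "(\<integral>\<^sup>+x. ennreal (exp (l * f x)) \<partial>measure_pmf p) \<le> ennreal (exp (l\<^sup>2 * b\<^sup>2 / 2))"
proof -
  interpret interval_bounded_random_variable "measure_pmf p" f "- b" b
    by unfold_locales (use b in \<open>force simp: AE_measure_pmf_iff abs_le_iff\<close>)+
  have "(\<integral>\<^sup>+x. ennreal (exp (l * f x)) \<partial>measure_pmf p) \<le> ennreal (exp (l\<^sup>2 * (b - - b)\<^sup>2 / 8))"
    by (rule Hoeffdings_lemma_nn_integral_0[OF l E])
  also have "l\<^sup>2 * (b - - b)\<^sup>2 / 8 = l\<^sup>2 * b\<^sup>2 / 2"
    by (simp add: power2_eq_square)
  finally show ?thesis .
qed

text \<open>Azuma's bound with the fixed rate \<open>1 / (b sqrt n)\<close>, which costs a factor \<open>sqrt L\<close>.\<close>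

lemma bounded_noise_tail:
  assumes n: "0 < n" and b: "0 < b"
    and bound: "\<And>hist x. length hist < n \<Longrightarrow> hist \<in> set_pmf (rollout \<beta> \<kappa> (length hist) s) \<Longrightarrow>
      x \<in> set_pmf (step_pmf \<beta> \<kappa> s hist) \<Longrightarrow> \<bar>g hist x\<bar> \<le> b"
    and mean: "\<And>hist. length hist < n \<Longrightarrow> hist \<in> set_pmf (rollout \<beta> \<kappa> (length hist) s) \<Longrightarrow>
      measure_pmf.expectation (step_pmf \<beta> \<kappa> s hist) (g hist) = 0"
  shows "measure_pmf.prob (rollout \<beta> \<kappa> n s)
    {\<omega>. b * sqrt (real n) * (1 / 2 + L) < (\<Sum>i<n. g (take i \<omega>) (\<omega> ! i))} \<le> exp (- L)"
proof -
  define l where "l = 1 / (b * sqrt (real n))"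
  have l: "0 < l" using n b by (simp add: l_def)
  have lb: "l\<^sup>2 * b\<^sup>2 = 1 / real n" using n b by (simp add: l_def power_divide power_mult_distrib)
  \<comment> \<open>The compensator \<open>1 / (2 n)\<close> equals \<open>l^2 b^2 / 2\<close>,
    Hoeffding's exponent for one step; over \<open>n\<close> steps it adds up to the
    \<open>1 / 2\<close> in the threshold.\<close>
  let ?g = "\<lambda>hist x. l * g hist x - 1 / (2 * real n)"
  have "measure_pmf.prob (rollout \<beta> \<kappa> n s)
      {\<omega>. b * sqrt (real n) * (1 / 2 + L) < (\<Sum>i<n. g (take i \<omega>) (\<omega> ! i))}
    \<le> measure_pmf.prob (rollout \<beta> \<kappa> n s) {\<omega>. L \<le> (\<Sum>i<n. ?g (take i \<omega>) (\<omega> ! i))}"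
  proof (rule measure_pmf.finite_measure_mono)
    show "{\<omega>. b * sqrt (real n) * (1 / 2 + L) < (\<Sum>i<n. g (take i \<omega>) (\<omega> ! i))} \<subseteq>
      {\<omega>. L \<le> (\<Sum>i<n. ?g (take i \<omega>) (\<omega> ! i))}"
    proof (rule Collect_mono, rule impI)
      fix \<omega>
      assume "b * sqrt (real n) * (1 / 2 + L) < (\<Sum>i<n. g (take i \<omega>) (\<omega> ! i))"
      hence "l * (b * sqrt (real n) * (1 / 2 + L)) \<le> l * (\<Sum>i<n. g (take i \<omega>) (\<omega> ! i))"
        using l by (intro mult_left_mono) auto
      moreover have "l * (b * sqrt (real n) * (1 / 2 + L)) = 1 / 2 + L"
        using n b by (simp add: l_def)
      moreover have "(\<Sum>i<n. ?g (take i \<omega>) (\<omega> ! i)) = l * (\<Sum>i<n. g (take i \<omega>) (\<omega> ! i)) - 1 / 2"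
        using n by (simp add: sum_subtractf sum_distrib_left)
      ultimately show "L \<le> (\<Sum>i<n. ?g (take i \<omega>) (\<omega> ! i))" by linarith
    qed
  qed simp
  also have "\<dots> \<le> exp (- L)"
  proof (rule exp_supermartingale_tail)
    fix hist assume h: "length hist < n" "hist \<in> set_pmf (rollout \<beta> \<kappa> (length hist) s)"
    let ?p = "step_pmf \<beta> \<kappa> s hist"
    have "(\<integral>\<^sup>+x. ennreal (exp (?g hist x)) \<partial>?p) =
        (\<integral>\<^sup>+x. ennreal (exp (- 1 / (2 * real n))) * ennreal (exp (l * g hist x)) \<partial>?p)"
      by (simp add: ennreal_mult[symmetric] exp_add[symmetric])
    also have "\<dots> = ennreal (exp (- 1 / (2 * real n))) * (\<integral>\<^sup>+x. ennreal (exp (l * g hist x)) \<partial>?p)"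
      by (simp add: nn_integral_cmult)
    also have "\<dots> \<le> ennreal (exp (- 1 / (2 * real n))) * ennreal (exp (l\<^sup>2 * b\<^sup>2 / 2))"
      using bound[OF h] mean[OF h] l by (intro mult_left_mono pmf_hoeffding) auto
    also have "\<dots> = 1"
      by (simp add: lb ennreal_mult[symmetric] exp_add[symmetric])
    finally show "(\<integral>\<^sup>+x. ennreal (exp (?g hist x)) \<partial>?p) \<le> 1" .
  qed
  finally show ?thesis .
qed

section \<open>One-step expectations and widths of the confidence sets\<close>

lemma expectation_step_pmf:
  fixes f :: "'s \<times> 'a \<times> 's \<Rightarrow> real"
  assumes fin: "finite X" "finite Y"
    and b: "set_pmf (\<beta> hist (cur_state s hist)) \<subseteq> Y"
    and k: "\<And>a. a \<in> Y \<Longrightarrow> set_pmf (\<kappa> hist (cur_state s hist) a) \<subseteq> X"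
  shows "measure_pmf.expectation (step_pmf \<beta> \<kappa> s hist) f =
    (\<Sum>a\<in>Y. pmf (\<beta> hist (cur_state s hist)) a *
      (\<Sum>y\<in>X. pmf (\<kappa> hist (cur_state s hist) a) y * f (cur_state s hist, a, y)))"
proof -
  let ?c = "cur_state s hist"
  have fk: "finite (set_pmf (map_pmf (\<lambda>s'. (?c, a, s')) (\<kappa> hist ?c a)))" if "a \<in> Y" for a
    using finite_subset[OF k[OF that] fin(1)] by simp
  have "measure_pmf.expectation (step_pmf \<beta> \<kappa> s hist) f =
    (\<Sum>a\<in>Y. pmf (\<beta> hist ?c) a * measure_pmf.expectation (map_pmf (\<lambda>s'. (?c, a, s')) (\<kappa> hist ?c a)) f)"
    unfolding step_pmf_def by (subst pmf_expectation_bind[OF fin(2) _ b], erule fk) simp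
  also have "\<dots> = (\<Sum>a\<in>Y. pmf (\<beta> hist ?c) a * (\<Sum>y\<in>X. pmf (\<kappa> hist ?c a) y * f (?c, a, y)))"
  proof (intro sum.cong refl arg_cong2[where f = "(*)"])
    fix a assume a: "a \<in> Y"
    have "measure_pmf.expectation (\<kappa> hist ?c a) (\<lambda>y. f (?c, a, y)) =
        (\<Sum>y\<in>X. pmf (\<kappa> hist ?c a) y *\<^sub>R f (?c, a, y))"
      using k[OF a] by (intro integral_measure_pmf[OF fin(1)]) auto
    thus "measure_pmf.expectation (map_pmf (\<lambda>s'. (?c, a, s')) (\<kappa> hist ?c a)) f =
        (\<Sum>y\<in>X. pmf (\<kappa> hist ?c a) y * f (?c, a, y))" by simp
  qed
  finally show ?thesis .
qed

lemma sum_trans_visits_le: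
  "finite X \<Longrightarrow> (\<Sum>y\<in>X. trans_visits hist s a y) \<le> visits hist s a"
proof (induction hist)
  case (Cons z hist)
  obtain x b y where z: "z = (x, b, y)" by (cases z) auto
  have "trans_visits (z # hist) s a y' = trans_visits hist s a y' + (if y' = y then of_bool (x = s \<and> b = a) else 0)" for y'
    by (auto simp: z trans_visits_def)
  hence "(\<Sum>y\<in>X. trans_visits (z # hist) s a y) =
      (\<Sum>y\<in>X. trans_visits hist s a y) + (\<Sum>y'\<in>X. if y' = y then of_bool (x = s \<and> b = a) else 0)"
    by (simp add: sum.distrib)
  also have "(\<Sum>y'\<in>X. if y' = y then of_bool (x = s \<and> b = a) else 0) \<le> (of_bool (x = s \<and> b = a) :: nat)"
    using Cons.prems by simp
  finally show ?case using Cons.IH[OF Cons.prems] by (auto simp: z visits_def)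
qed (simp add: trans_visits_def)

lemma visits_take_eq_occurrences:
  "t \<le> length \<omega> \<Longrightarrow> visits (take t \<omega>) s a = occurrences (\<lambda>i. (fst (\<omega> ! i), fst (snd (\<omega> ! i)))) (s, a) t"
  by (induction t) (auto simp: visits_def occurrences_Suc take_Suc_conv_app_nth)

text \<open>Empirical frequencies have total mass at most 1 (and 0 before the first visit), so
  Cauchy-Schwarz over the next states yields the square root of \<open>card X\<close> in the leading
  term instead of \<open>card X\<close>.\<close>

lemma l1_radius_sum:
  fixes X :: "'s set" and hist :: "('s, 'a) history"
  assumes X: "finite X" and L: "0 \<le> L"
  shows "(\<Sum>y\<in>X. 4 * sqrt (emp_trans hist s a y * (L / visits_plus hist s a)) + 28 * (L / visits_plus hist s a))
    \<le> 4 * sqrt (real (card X) * (L / visits_plus hist s a)) + 28 * real (card X) * (L / visits_plus hist s a)"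
proof -
  define \<alpha> where "\<alpha> = L / visits_plus hist s a"
  have v: "0 < visits_plus hist s a" "real (visits hist s a) \<le> visits_plus hist s a"
    by (auto simp: visits_plus_def)
  have a: "0 \<le> \<alpha>" using L v by (simp add: \<alpha>_def)
  have e: "0 \<le> emp_trans hist s a y" for y using v by (simp add: emp_trans_def)
  have "(\<Sum>y\<in>X. emp_trans hist s a y) = real (\<Sum>y\<in>X. trans_visits hist s a y) / visits_plus hist s a"
    by (simp add: emp_trans_def sum_divide_distrib)
  also have "\<dots> \<le> 1"
  proof -
    have "real (\<Sum>y\<in>X. trans_visits hist s a y) \<le> real (visits hist s a)"
      using sum_trans_visits_le[OF X, of hist s a] by (simp only: of_nat_le_iff)
    thus ?thesis using v unfolding divide_le_eq_1 by linarith
  qed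
  finally have e1: "(\<Sum>y\<in>X. emp_trans hist s a y) \<le> 1" .
  have "(\<Sum>y\<in>X. 1 * sqrt (emp_trans hist s a y * \<alpha>))\<^sup>2 \<le>
      (\<Sum>y\<in>X. 1\<^sup>2) * (\<Sum>y\<in>X. (sqrt (emp_trans hist s a y * \<alpha>))\<^sup>2)"
    by (rule Cauchy_Schwarz_ineq_sum)
  also have "(\<Sum>y\<in>X. (sqrt (emp_trans hist s a y * \<alpha>))\<^sup>2) = (\<Sum>y\<in>X. emp_trans hist s a y) * \<alpha>"
    using a e by (simp add: sum_distrib_right)
  also have "\<dots> \<le> 1 * \<alpha>" by (rule mult_right_mono[OF e1 a])
  finally have "(\<Sum>y\<in>X. sqrt (emp_trans hist s a y * \<alpha>))\<^sup>2 \<le> real (card X) * \<alpha>"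
    by (simp add: mult_left_mono)
  hence "(\<Sum>y\<in>X. sqrt (emp_trans hist s a y * \<alpha>)) \<le> sqrt (real (card X) * \<alpha>)"
    by (rule real_le_rsqrt)
  thus ?thesis unfolding \<alpha>_def[symmetric]
    by (simp add: sum.distrib flip: sum_distrib_left)
qed

text \<open>The difference of two distributions has total mass 0, so a constant can be subtracted
  from \<open>v\<close> and only its oscillation counts. Here the span takes the place of the
  horizon.\<close>

lemma pmf_difference_span_le:
  fixes v :: "'s \<Rightarrow> real"
  assumes fin: "finite X" and p: "set_pmf p \<subseteq> X" and q: "set_pmf q \<subseteq> X"
    and b: "\<And>x y. x \<in> X \<Longrightarrow> y \<in> X \<Longrightarrow> v x - v y \<le> b"
  shows "\<bar>\<Sum>y\<in>X. (pmf p y - pmf q y) * v y\<bar> \<le> b * (\<Sum>y\<in>X. \<bar>pmf p y - pmf q y\<bar>)"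
proof -
  obtain x where x: "x \<in> X" using p set_pmf_not_empty by fastforce
  have "(\<Sum>y\<in>X. (pmf p y - pmf q y) * v y) = (\<Sum>y\<in>X. (pmf p y - pmf q y) * (v y - v x))"
    using sum_pmf_eq_1[OF fin p] sum_pmf_eq_1[OF fin q]
    by (simp add: right_diff_distrib sum_subtractf left_diff_distrib flip: sum_distrib_right)
  also have "\<bar>\<dots>\<bar> \<le> (\<Sum>y\<in>X. \<bar>pmf p y - pmf q y\<bar> * b)"
    using b x by (intro order_trans[OF sum_abs] sum_mono) (auto simp: abs_mult abs_le_iff intro!: mult_left_mono)
  finally show ?thesis by (simp add: mult.commute flip: sum_distrib_left)
qed

section \<open>Optimism and the noise of the learner\<close>

locale cmdp_learning =
  fixes M :: "('s, 'a) cmdp" and \<pi>s :: "'s \<Rightarrow> 'a pmf" and Jr Jc :: real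
    and qr qc :: "'s \<Rightarrow> 'a \<Rightarrow> real" and spr spc \<delta> :: real and T H K :: nat
    and plan :: "('s, 'a) planner" and s1 :: 's
  assumes M: "cmdp M" and opt: "optimal_policy M \<pi>s Jr Jc"
    and qr: "is_bias M \<pi>s (reward M) qr" and spr: "spr = span_on (states M) (policy_avg M \<pi>s qr)"
    and qc: "is_bias M \<pi>s (cost M) qc" and spc: "spc = span_on (states M) (policy_avg M \<pi>s qc)"
    and \<delta>: "0 < \<delta>" "\<delta> < 1" and T: "0 < T"
    and H_eq: "real H = sqrt (real T / (real (card (states M)) ^ 2 * real (card (actions M))))"
    and K_eq: "real K = real T / real H"
    and planner: "valid_planner M T H K \<delta> spr spc plan"
    and s1: "s1 \<in> states M"
begin

abbreviation "S \<equiv> states M"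
abbreviation "A \<equiv> actions M"
abbreviation "L \<equiv> log_term M T \<delta>"
abbreviation "R \<equiv> rollout (learner H plan s1) (\<lambda>_. trans M) T s1"

section \<open>Arithmetic of the episode length and the number of episodes\<close>

lemma fin: "finite S" "finite A" "S \<noteq> {}" "A \<noteq> {}"
  using M by (auto simp: cmdp_def)

lemma card_pos: "0 < card S" "0 < card A"
  using fin by (auto simp: card_gt_0_iff)

lemma H_pos: "0 < H"
proof -
  have "0 < real H" unfolding H_eq using T card_pos by simp
  thus ?thesis by simp
qed

lemma KH: "K * H = T"
proof -
  have "real K * real H = real T" using K_eq H_pos by simp
  thus ?thesis by (metis of_nat_eq_iff of_nat_mult)
qed

lemma T_eq: "T = (H * card S)\<^sup>2 * card A"
proof -
  have "(real H)\<^sup>2 = real T / (real (card S) ^ 2 * real (card A))"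
    unfolding H_eq by simp
  hence "real T = (real H * real (card S))\<^sup>2 * real (card A)"
    using card_pos by (simp add: field_simps)
  also have "\<dots> = real ((H * card S)\<^sup>2 * card A)" by simp
  finally show ?thesis by (simp only: of_nat_eq_iff)
qed

text \<open>This identity makes every error source comparable with \<open>K\<close>: the
  \<open>H S A\<close> steps that one doubling of all counts may cost, the lower-order confidence
  terms of size \<open>S^2 A\<close>, and \<open>sqrt T\<close>.\<close>

lemma K_card: "K = H * (card S)\<^sup>2 * card A"
proof -
  have "K * H = H * (card S)\<^sup>2 * card A * H"
    using KH T_eq by (simp add: power2_eq_square ac_simps)
  thus ?thesis using H_pos by simp
qed

text \<open>Losing one span per episode therefore costs exactly the rate of the theorem.\<close>

lemma K_rate: "real K = real (card S) * sqrt (real (card A) * real T)"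
proof -
  have "(real (card S) * sqrt (real (card A) * real T))\<^sup>2 = (real (card S))\<^sup>2 * (real (card A) * real T)"
    by (simp add: power_mult_distrib)
  also have "\<dots> = (real K)\<^sup>2" unfolding T_eq K_card by (simp add: power2_eq_square)
  finally show ?thesis
    by (metis abs_of_nonneg mult_nonneg_nonneg of_nat_0_le_iff real_sqrt_abs real_sqrt_ge_zero)
qed

lemma L_ge: "1 / 2 \<le> L" "ln (2 * real T) \<le> L"
  using log_term_ge_ln2[OF M \<delta> T] by auto

lemma trans_in: "x \<in> S \<Longrightarrow> a \<in> A \<Longrightarrow> set_pmf (trans M x a) \<subseteq> S"
  using M by (auto simp: cmdp_def)

text \<open>The plan in force depends on the current history through its completed episodes. Writing
  all planned objects in this way makes noise and drift functions of the history, as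
  \<open>bounded_noise_tail\<close> demands, although the plan changes only between
  episodes.\<close>

definition past :: "('s, 'a) history \<Rightarrow> ('s, 'a) history" where
  "past hist = take (length hist div H * H) hist"

definition start :: "('s, 'a) history \<Rightarrow> 's" where
  "start hist = cur_state s1 (past hist)"

definition occ_of :: "('s, 'a) history \<Rightarrow> ('s, 'a) occ" where
  "occ_of hist = fst (plan (past hist) (start hist))"

definition pol_of :: "('s, 'a) history \<Rightarrow> ('s, 'a) ns_policy" where
  "pol_of hist = fst (snd (plan (past hist) (start hist)))"

definition ker_of :: "('s, 'a) history \<Rightarrow> ('s, 'a) ns_trans" where
  "ker_of hist = snd (snd (plan (past hist) (start hist)))"

definition step_of :: "('s, 'a) history \<Rightarrow> nat" where
  "step_of hist = length hist mod H + 1"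

definition feasible :: "('s, 'a) history \<Rightarrow> bool" where
  "feasible hist \<longleftrightarrow> feasible_set M T H \<delta> spr spc (past hist) (start hist) \<noteq> {}"

definition Val :: "('s \<Rightarrow> 'a \<Rightarrow> real) \<Rightarrow> ('s, 'a) history \<Rightarrow> nat \<Rightarrow> 's \<Rightarrow> real" where
  "Val d hist h x = value_fn H (pol_of hist) (ker_of hist) d h x"

definition drift :: "('s \<Rightarrow> 'a \<Rightarrow> real) \<Rightarrow> ('s, 'a) history \<Rightarrow> 's \<times> 'a \<times> 's \<Rightarrow> real" where
  "drift d hist z = (case z of (x, a, _) \<Rightarrow>
     \<Sum>y\<in>S. (pmf (ker_of hist x a (step_of hist)) y - pmf (trans M x a) y) * Val d hist (Suc (step_of hist)) y)"

text \<open>Subtracting the drift centres the difference under the true transition function. The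
  value 0 for infeasible programs keeps it centred and bounded at every reachable history, so its
  tail bound holds without conditioning on the confidence event.\<close>

definition noise :: "('s \<Rightarrow> 'a \<Rightarrow> real) \<Rightarrow> ('s, 'a) history \<Rightarrow> 's \<times> 'a \<times> 's \<Rightarrow> real" where
  "noise d hist z = (case z of (x, a, y) \<Rightarrow> if feasible hist
     then Val d hist (step_of hist) x - d x a - Val d hist (Suc (step_of hist)) y - drift d hist z else 0)"

definition legal :: "('s, 'a) history \<Rightarrow> bool" where
  "legal hist \<longleftrightarrow> length hist < T \<and> set hist \<subseteq> S \<times> A \<times> S"

lemma step_of_in: "step_of hist \<in> {1..H}"
  using H_pos by (simp add: step_of_def Suc_leI)

lemma learner_eq: "learner H plan s1 hist s = pol_of hist s (step_of hist)"
  by (simp add: learner_def pol_of_def past_def start_def step_of_def Let_def)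

lemma legal_past:
  assumes "legal hist"
  shows "\<exists>k\<in>{1..K}. length (past hist) = (k - 1) * H" "set (past hist) \<subseteq> S \<times> A \<times> S" "start hist \<in> S"
proof -
  have l: "length hist < K * H" and s: "set hist \<subseteq> S \<times> A \<times> S" using assms KH by (auto simp: legal_def)
  have "length hist div H < K" using l H_pos by (simp add: div_less_iff_less_mult)
  moreover have "length (past hist) = length hist div H * H"
    by (simp add: past_def)
  ultimately show "\<exists>k\<in>{1..K}. length (past hist) = (k - 1) * H"
    by (intro bexI[of _ "Suc (length hist div H)"]) auto
  show *: "set (past hist) \<subseteq> S \<times> A \<times> S"
    unfolding past_def using s set_take_subset by (rule order_trans[rotated])
  show "start hist \<in> S" unfolding start_def by (rule cur_state_in[OF * s1])
qed

lemma legal_plan: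
  assumes "legal hist"
  shows "ns_policy M H (pol_of hist)"
    and "feasible hist \<Longrightarrow> (occ_of hist, pol_of hist, ker_of hist) \<in> feasible_set M T H \<delta> spr spc (past hist) (start hist)"
    and "(\<nu>, \<pi>, P) \<in> feasible_set M T H \<delta> spr spc (past hist) (start hist) \<Longrightarrow>
      occ_inner M H \<nu> (reward M) \<le> occ_inner M H (occ_of hist) (reward M)"
proof -
  obtain k where k: "k \<in> {1..K}" "length (past hist) = (k - 1) * H"
    using legal_past(1)[OF assms] by blast
  note * = planner[unfolded valid_planner_def, rule_format, OF k(1) legal_past(3)[OF assms]
      conjI[OF k(2) legal_past(2)[OF assms]]]
  show "ns_policy M H (pol_of hist)" unfolding pol_of_def using * by blast
  show "(occ_of hist, pol_of hist, ker_of hist) \<in> feasible_set M T H \<delta> spr spc (past hist) (start hist)"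
    if "feasible hist"
    using * that by (simp add: feasible_def occ_of_def pol_of_def ker_of_def)
  show "occ_inner M H \<nu> (reward M) \<le> occ_inner M H (occ_of hist) (reward M)"
    if "(\<nu>, \<pi>, P) \<in> feasible_set M T H \<delta> spr spc (past hist) (start hist)"
  proof -
    have "feasible_set M T H \<delta> spr spc (past hist) (start hist) \<noteq> {}" using that by blast
    with * have "\<forall>(\<nu>, \<pi>, P)\<in>feasible_set M T H \<delta> spr spc (past hist) (start hist).
              occ_inner M H \<nu> (reward M) \<le> occ_inner M H (fst (plan (past hist) (start hist))) (reward M)"
      by blast
    from bspec[OF this that] show ?thesis by (simp add: occ_of_def)
  qed
qed

lemma legal_feasible:
  assumes "legal hist" "feasible hist"
  shows "ns_trans M H (ker_of hist)" "ker_of hist \<in> conf_set M T H \<delta> (past hist)"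
    and "occ_inner M H (occ_of hist) d = Val d hist 1 (start hist)"
    and "occ_inner M H (occ_of hist) (cost M) \<le> real H * threshold M + spc"
    and "h \<in> {1..H} \<Longrightarrow> span_on S (Val (reward M) hist h) \<le> 2 * spr"
    and "h \<in> {1..H} \<Longrightarrow> span_on S (Val (cost M) hist h) \<le> 2 * spc"
proof -
  note f = legal_plan(2)[OF assms]
  hence s: "(occ_of hist, pol_of hist, ker_of hist) \<in> search_space M T H \<delta> spr spc (past hist) (start hist)"
    and c: "occ_inner M H (occ_of hist) (cost M) \<le> real H * threshold M + spc"
    unfolding feasible_set_def by blast+
  from s have o: "occ_of hist \<in> occ_measures M H (start hist)"
    and ip: "induced_policy M H (occ_of hist) (pol_of hist)"
    and it: "induced_trans M H (occ_of hist) (ker_of hist)"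
    and cs: "ker_of hist \<in> conf_set M T H \<delta> (past hist)"
    and sp: "\<forall>h\<in>{1..H}. span_on S (value_fn H (pol_of hist) (ker_of hist) (reward M) h) \<le> 2 * spr \<and>
                    span_on S (value_fn H (pol_of hist) (ker_of hist) (cost M) h) \<le> 2 * spc"
    unfolding search_space_def by blast+
  show "ns_trans M H (ker_of hist)" using it by (simp add: induced_trans_def)
  show "ker_of hist \<in> conf_set M T H \<delta> (past hist)" by (rule cs)
  show "occ_inner M H (occ_of hist) (cost M) \<le> real H * threshold M + spc" by (rule c)
  show "occ_inner M H (occ_of hist) d = Val d hist 1 (start hist)"
    unfolding Val_def using H_pos
    by (intro occ_inner_eq_value_fn[OF M o ip it legal_past(3)[OF assms(1)]]) simp
  have V: "Val d hist h = value_fn H (pol_of hist) (ker_of hist) d h" for d h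
    by (rule ext) (simp add: Val_def)
  show "h \<in> {1..H} \<Longrightarrow> span_on S (Val (reward M) hist h) \<le> 2 * spr"
    and "h \<in> {1..H} \<Longrightarrow> span_on S (Val (cost M) hist h) \<le> 2 * spc"
    using sp by (simp_all add: V)
qed

lemma sp_nonneg: "0 \<le> spr" "0 \<le> spc"
  unfolding spr spc using fin by (simp_all add: span_on_nonneg)

lemma opt_stationary: "stationary_policy M \<pi>s"
  and opt_reward: "\<And>s. s \<in> S \<Longrightarrow> avg_util M \<pi>s (reward M) s = Jr"
  and opt_cost: "\<And>s. s \<in> S \<Longrightarrow> avg_util M \<pi>s (cost M) s = Jc"
  and Jc_le: "Jc \<le> threshold M"
proof -
  show "stationary_policy M \<pi>s" "\<And>s. s \<in> S \<Longrightarrow> avg_util M \<pi>s (reward M) s = Jr"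
    and *: "\<And>s. s \<in> S \<Longrightarrow> avg_util M \<pi>s (cost M) s = Jc"
    using opt by (auto simp: optimal_policy_def)
  have "avg_util M \<pi>s (cost M) s1 \<le> threshold M" using opt s1 by (auto simp: optimal_policy_def)
  thus "Jc \<le> threshold M" using *[OF s1] by simp
qed

lemma optimism:
  assumes legal: "legal hist" and conf: "(\<lambda>x a h. trans M x a) \<in> conf_set M T H \<delta> (past hist)"
  shows "feasible hist" and "real H * Jr - spr \<le> Val (reward M) hist 1 (start hist)"
proof -
  note s = legal_past(3)[OF legal]
  obtain \<nu> where nu: "\<nu> \<in> occ_measures M H (start hist)"
    and ip: "induced_policy M H \<nu> (\<lambda>x _. \<pi>s x)" and it: "induced_trans M H \<nu> (\<lambda>x a _. trans M x a)"
    using stationary_occ_measure[OF M opt_stationary s] by blast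
  have val: "occ_inner M H \<nu> d = value_fn H (\<lambda>x _. \<pi>s x) (\<lambda>x a _. trans M x a) d 1 (start hist)" for d
    using H_pos by (intro occ_inner_eq_value_fn[OF M nu ip it s]) simp
  note r = stationary_value_fn_span[OF M opt_stationary opt_reward qr, where H = H, folded spr]
  note c = stationary_value_fn_span[OF M opt_stationary opt_cost qc, where H = H, folded spc]
  have "\<bar>occ_inner M H \<nu> (cost M) - real H * Jc\<bar> \<le> spc"
    using c(1)[of 1 "start hist"] s unfolding val by simp
  moreover have "real H * Jc \<le> real H * threshold M" using Jc_le by (intro mult_left_mono) auto
  ultimately have cost: "occ_inner M H \<nu> (cost M) \<le> real H * threshold M + spc" by linarith
  \<comment> \<open>The slack \<open>spc\<close> in the cost constraint exists for this comparator,
    whose cost over \<open>H\<close> steps may exceed \<open>H Jc\<close> by the span of its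
    bias.\<close>
  have f: "(\<nu>, \<lambda>x _. \<pi>s x, \<lambda>x a _. trans M x a) \<in> feasible_set M T H \<delta> spr spc (past hist) (start hist)"
    unfolding feasible_set_def search_space_def
    using nu ip it conf cost r(2) c(2) by simp
  thus feas: "feasible hist" unfolding feasible_def by blast
  have "\<bar>occ_inner M H \<nu> (reward M) - real H * Jr\<bar> \<le> spr"
    using r(1)[of 1 "start hist"] s unfolding val by simp
  thus "real H * Jr - spr \<le> Val (reward M) hist 1 (start hist)"
    using legal_plan(3)[OF legal f] legal_feasible(3)[OF legal feas, of "reward M"] by linarith
qed

text \<open>Reward and cost are paired with their spans so that noise and drift are bounded once for
  both.\<close>

definition utility :: "('s \<Rightarrow> 'a \<Rightarrow> real) \<Rightarrow> real \<Rightarrow> bool" where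
  "utility d sp \<longleftrightarrow> (d, sp) \<in> {(reward M, spr), (cost M, spc)}"

lemma utility_range: "utility d sp \<Longrightarrow> x \<in> S \<Longrightarrow> a \<in> A \<Longrightarrow> 0 \<le> d x a \<and> d x a \<le> 1"
  using M by (auto simp: utility_def cmdp_def)

lemma utility_nonneg: "utility d sp \<Longrightarrow> 0 \<le> sp"
  using sp_nonneg by (auto simp: utility_def)

text \<open>The index runs one past the span constraints of the program because noise and drift
  involve the value at the next step; at \<open>Suc H\<close> it is 0.\<close>

lemma Val_osc:
  assumes u: "utility d sp" and "legal hist" "feasible hist" and h: "h \<in> {1..Suc H}"
    and xy: "x \<in> S" "y \<in> S"
  shows "Val d hist h x - Val d hist h y \<le> 2 * sp"
proof (cases "h = Suc H")
  case True
  thus ?thesis using utility_nonneg[OF u] by (simp add: Val_def)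
next
  case False
  hence "h \<in> {1..H}" using h by auto
  hence "span_on S (Val d hist h) \<le> 2 * sp"
    using legal_feasible(5,6)[OF assms(2,3)] u by (auto simp: utility_def)
  thus ?thesis using span_on_ge[OF fin(1) xy, of "Val d hist h"] by linarith
qed

lemma Val_Bellman:
  assumes "legal hist" "feasible hist" "x \<in> S"
  shows "Val d hist (step_of hist) x = (\<Sum>a\<in>A. pmf (pol_of hist x (step_of hist)) a *
    (d x a + (\<Sum>y\<in>S. pmf (ker_of hist x a (step_of hist)) y * Val d hist (Suc (step_of hist)) y)))"
  unfolding Val_def
  by (rule value_fn_Suc[OF M legal_plan(1)[OF assms(1)] legal_feasible(1)[OF assms(1,2)] assms(3) step_of_in])

lemma pol_support: "legal hist \<Longrightarrow> x \<in> S \<Longrightarrow> set_pmf (pol_of hist x (step_of hist)) \<subseteq> A"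
  using legal_plan(1) step_of_in unfolding ns_policy_def by blast

lemma ker_support:
  "legal hist \<Longrightarrow> feasible hist \<Longrightarrow> x \<in> S \<Longrightarrow> a \<in> A \<Longrightarrow> set_pmf (ker_of hist x a (step_of hist)) \<subseteq> S"
  using legal_feasible(1) step_of_in unfolding ns_trans_def by blast

lemma cur_state_legal: "legal hist \<Longrightarrow> cur_state s1 hist \<in> S"
  by (rule cur_state_in[OF _ s1]) (auto simp: legal_def)

text \<open>The two sources of randomness: the first part averages to 0 over the planned action by
  the Bellman equation, the second over the true next state.\<close>

lemma noise_eq:
  assumes "feasible hist"
  shows "noise d hist (x, a, y) =
    (Val d hist (step_of hist) x - (d x a + (\<Sum>y\<in>S. pmf (ker_of hist x a (step_of hist)) y * Val d hist (Suc (step_of hist)) y)))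
    + ((\<Sum>y\<in>S. pmf (trans M x a) y * Val d hist (Suc (step_of hist)) y) - Val d hist (Suc (step_of hist)) y)"
  using assms by (simp add: noise_def drift_def left_diff_distrib sum_subtractf)

lemma noise_mean:
  assumes l: "legal hist"
  shows "measure_pmf.expectation (step_pmf (learner H plan s1) (\<lambda>_. trans M) s1 hist) (noise d hist) = 0"
proof (cases "feasible hist")
  case False
  hence "noise d hist = (\<lambda>_. 0)" by (auto simp: noise_def)
  thus ?thesis by simp
next
  case f: True
  define x where "x = cur_state s1 hist"
  define h where "h = step_of hist"
  define V' where "V' = Val d hist (Suc h)"
  define Q where "Q = (\<lambda>a. d x a + (\<Sum>y\<in>S. pmf (ker_of hist x a h) y * V' y))"
  have x: "x \<in> S" unfolding x_def by (rule cur_state_legal[OF l])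
  have V: "Val d hist h x = (\<Sum>a\<in>A. pmf (pol_of hist x h) a * Q a)"
    using Val_Bellman[OF l f x, of d] by (simp add: h_def V'_def Q_def)
  have "measure_pmf.expectation (step_pmf (learner H plan s1) (\<lambda>_. trans M) s1 hist) (noise d hist) =
    (\<Sum>a\<in>A. pmf (pol_of hist x h) a * (\<Sum>y\<in>S. pmf (trans M x a) y * noise d hist (x, a, y)))"
    using pol_support[OF l x] trans_in[OF x]
    by (subst expectation_step_pmf[OF fin(1,2)]) (simp_all add: learner_eq x_def h_def)
  also have "\<dots> = (\<Sum>a\<in>A. pmf (pol_of hist x h) a * (- Q a + Val d hist h x))"
  proof (intro sum.cong refl arg_cong2[where f = "(*)"])
    fix a assume a: "a \<in> A"
    define m where "m = (\<Sum>y\<in>S. pmf (trans M x a) y * V' y)"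
    have "(\<Sum>y\<in>S. pmf (trans M x a) y * noise d hist (x, a, y)) =
        (\<Sum>y\<in>S. pmf (trans M x a) y * (- V' y + (Val d hist h x - Q a + m)))"
      by (intro sum.cong refl arg_cong2[where f = "(*)"]) (simp add: noise_eq[OF f] Q_def h_def V'_def m_def)
    also have "\<dots> = (\<Sum>y\<in>S. pmf (trans M x a) y * (- V' y)) + (Val d hist h x - Q a + m)"
      by (rule pmf_weighted_add_const[OF fin(1) trans_in[OF x a]])
    also have "(\<Sum>y\<in>S. pmf (trans M x a) y * (- V' y)) = - m"
      by (simp add: m_def sum_negf)
    finally show "(\<Sum>y\<in>S. pmf (trans M x a) y * noise d hist (x, a, y)) = - Q a + Val d hist h x" by simp
  qed
  also have "\<dots> = (\<Sum>a\<in>A. pmf (pol_of hist x h) a * (- Q a)) + Val d hist h x"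
    unfolding h_def by (rule pmf_weighted_add_const[OF fin(2) pol_support[OF l x]])
  also have "\<dots> = 0" by (simp add: V sum_negf)
  finally show ?thesis .
qed

text \<open>Action values at one state differ by at most 1 from the immediate utility plus
  \<open>2 sp\<close> from the next value; the random next state contributes another
  \<open>2 sp\<close>.\<close>

lemma noise_bound:
  assumes u: "utility d sp" and l: "legal hist"
    and z: "z \<in> set_pmf (step_pmf (learner H plan s1) (\<lambda>_. trans M) s1 hist)"
  shows "\<bar>noise d hist z\<bar> \<le> 1 + 4 * sp"
proof (cases "feasible hist")
  case False
  thus ?thesis using utility_nonneg[OF u] by (simp add: noise_def split: prod.splits)
next
  case f: True
  define x where "x = cur_state s1 hist"
  define h where "h = step_of hist"
  define V' where "V' = Val d hist (Suc h)"
  define Q where "Q = (\<lambda>a. d x a + (\<Sum>y\<in>S. pmf (ker_of hist x a h) y * V' y))"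
  have x: "x \<in> S" unfolding x_def by (rule cur_state_legal[OF l])
  obtain a y where z: "z = (x, a, y)" and "a \<in> set_pmf (pol_of hist x h)" "y \<in> set_pmf (trans M x a)"
    using z by (auto simp: step_pmf_def learner_eq x_def h_def)
  hence a: "a \<in> A" and y: "y \<in> S"
    using pol_support[OF l x] trans_in[OF x] unfolding h_def by blast+
  have "Suc h \<in> {1..Suc H}" using step_of_in[of hist] by (simp add: h_def)
  hence osc: "V' y' - V' y'' \<le> 2 * sp" if "y' \<in> S" "y'' \<in> S" for y' y''
    unfolding V'_def by (rule Val_osc[OF u l f _ that])
  have avg: "\<bar>(\<Sum>y\<in>S. pmf p y * V' y) - V' y'\<bar> \<le> 2 * sp"
    if p: "set_pmf p \<subseteq> S" and y': "y' \<in> S" for p y'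
  proof -
    have "(\<Sum>y\<in>S. pmf p y * V' y) \<le> V' y' + 2 * sp"
      by (rule pmf_weighted_le[OF fin(1) p]) (use osc y' in force)
    moreover have "V' y' - 2 * sp \<le> (\<Sum>y\<in>S. pmf p y * V' y)"
      by (rule pmf_weighted_ge[OF fin(1) p]) (use osc y' in force)
    ultimately show ?thesis by linarith
  qed
  have avg2: "(\<Sum>y\<in>S. pmf p y * V' y) - (\<Sum>y\<in>S. pmf q y * V' y) \<le> 2 * sp"
    if p: "set_pmf p \<subseteq> S" and q: "set_pmf q \<subseteq> S" for p q
  proof -
    have "(\<Sum>y\<in>S. pmf p y * V' y) - 2 * sp \<le> (\<Sum>y\<in>S. pmf q y * V' y)"
      by (rule pmf_weighted_ge[OF fin(1) q]) (use avg[OF p] in \<open>force simp: abs_le_iff\<close>)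
    thus ?thesis by linarith
  qed
  have Q: "Q b - Q b' \<le> 1 + 2 * sp" if b: "b \<in> A" "b' \<in> A" for b b'
  proof -
    have "d x b - d x b' \<le> 1" using utility_range[OF u x b(1)] utility_range[OF u x b(2)] by linarith
    thus ?thesis
      using avg2[OF ker_support[OF l f x b(1)] ker_support[OF l f x b(2)]] by (simp add: Q_def h_def)
  qed
  have V: "Val d hist h x = (\<Sum>a\<in>A. pmf (pol_of hist x h) a * Q a)"
    using Val_Bellman[OF l f x, of d] by (simp add: h_def V'_def Q_def)
  have ps: "set_pmf (pol_of hist x h) \<subseteq> A" unfolding h_def by (rule pol_support[OF l x])
  have "Val d hist h x \<le> Q a + (1 + 2 * sp)"
    unfolding V by (rule pmf_weighted_le[OF fin(2) ps]) (use Q a in force)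
  moreover have "Q a - (1 + 2 * sp) \<le> Val d hist h x"
    unfolding V by (rule pmf_weighted_ge[OF fin(2) ps]) (use Q a in force)
  moreover have "noise d hist z = (Val d hist h x - Q a) + ((\<Sum>y\<in>S. pmf (trans M x a) y * V' y) - V' y)"
    unfolding z noise_eq[OF f] Q_def h_def V'_def ..
  ultimately show ?thesis using avg[OF trans_in[OF x a] y] by linarith
qed

lemma legal_rollout:
  assumes w: "\<omega> \<in> set_pmf (rollout (learner H plan s1) (\<lambda>_. trans M) n s1)" and n: "n \<le> T"
  shows "set \<omega> \<subseteq> S \<times> A \<times> S"
proof (rule set_rollout[OF _ _ s1 w])
  fix hist :: "('s, 'a) history" and x
  assume "length hist < n" "set hist \<subseteq> S \<times> A \<times> S" "x \<in> S"
  thus "set_pmf (learner H plan s1 hist x) \<subseteq> A"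
    unfolding learner_eq using n by (intro pol_support) (auto simp: legal_def)
qed (rule trans_in)

text \<open>Regret needs the upper tail of the reward noise, violation the lower tail of the cost
  noise; \<open>\<sigma>\<close> covers both.\<close>

lemma noise_tail:
  assumes u: "utility d sp" and \<sigma>: "\<sigma> \<in> {1, -1 :: real}"
  shows "measure_pmf.prob R {\<omega>. (1 + 4 * sp) * sqrt (real T) * (1 / 2 + L) <
      (\<Sum>i<T. \<sigma> * noise d (take i \<omega>) (\<omega> ! i))} \<le> \<delta>"
proof -
  have "measure_pmf.prob R {\<omega>. (1 + 4 * sp) * sqrt (real T) * (1 / 2 + L) <
      (\<Sum>i<T. \<sigma> * noise d (take i \<omega>) (\<omega> ! i))} \<le> exp (- L)"
  proof (rule bounded_noise_tail[where g = "\<lambda>hist z. \<sigma> * noise d hist z"])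
    show "0 < T" by (rule T)
    show "0 < 1 + 4 * sp" using utility_nonneg[OF u] by simp
    fix hist assume h: "length hist < T" "hist \<in> set_pmf (rollout (learner H plan s1) (\<lambda>_. trans M) (length hist) s1)"
    have l: "legal hist" using legal_rollout[OF h(2)] h(1) by (simp add: legal_def)
    show "\<bar>\<sigma> * noise d hist x\<bar> \<le> 1 + 4 * sp"
      if "x \<in> set_pmf (step_pmf (learner H plan s1) (\<lambda>_. trans M) s1 hist)" for x
      using noise_bound[OF u l that] \<sigma> by (auto simp: abs_mult)
    show "measure_pmf.expectation (step_pmf (learner H plan s1) (\<lambda>_. trans M) s1 hist)
      (\<lambda>z. \<sigma> * noise d hist z) = 0"
      using noise_mean[OF l, of d] by simp
  qed
  also have "exp (- L) \<le> \<delta>"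
  proof -
    have "1 \<le> 2 * real (card S) * real (card A) * real T"
    proof -
      have "1 \<le> 2 * card S * card A * T" using card_pos T by (simp add: Suc_le_eq)
      hence "real 1 \<le> real (2 * card S * card A * T)" by (simp only: of_nat_le_iff)
      thus ?thesis by simp
    qed
    hence "\<delta> / (2 * real (card S) * real (card A) * real T) \<le> \<delta> / 1"
      using \<delta>(1) by (intro divide_left_mono) (simp, simp, linarith)
    thus ?thesis unfolding exp_neg_log_term[OF M \<delta>(1) T] by simp
  qed
  finally show ?thesis .
qed

text \<open>Planned and true transition functions lie within the radius of the same empirical one,
  so their L1 distance is at most twice the summed radius; it is also at most 2. Multiplication by
  the oscillation \<open>2 sp\<close> gives 4, \<open>16 = 2 * 2 * 4\<close> and
  \<open>112 = 2 * 2 * 28\<close>. The crude bound serves the steps with badly outdated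
  counts.\<close>

lemma drift_bounds:
  assumes u: "utility d sp" and l: "legal hist" and f: "feasible hist"
    and conf: "(\<lambda>x a h. trans M x a) \<in> conf_set M T H \<delta> (past hist)"
    and x: "x \<in> S" and a: "a \<in> A"
  defines "v \<equiv> 1 / visits_plus (past hist) x a"
  shows "\<bar>drift d hist (x, a, y)\<bar> \<le> 4 * sp"
    and "\<bar>drift d hist (x, a, y)\<bar> \<le> 16 * sp * sqrt (real (card S) * L) * sqrt v + 112 * sp * real (card S) * L * v"
proof -
  define h where "h = step_of hist"
  define p where "p = ker_of hist x a h"
  define q where "q = trans M x a"
  have h: "h \<in> {1..H}" unfolding h_def by (rule step_of_in)
  have pS: "set_pmf p \<subseteq> S" unfolding p_def h_def by (rule ker_support[OF l f x a])
  have qS: "set_pmf q \<subseteq> S" unfolding q_def by (rule trans_in[OF x a])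
  have sp: "0 \<le> sp" by (rule utility_nonneg[OF u])
  have L0: "0 \<le> L" using L_ge by simp
  have main: "\<bar>drift d hist (x, a, y)\<bar> \<le> 2 * sp * (\<Sum>y\<in>S. \<bar>pmf p y - pmf q y\<bar>)"
    using pmf_difference_span_le[OF fin(1) pS qS Val_osc[OF u l f, of "Suc h"]] h
    by (simp add: drift_def p_def q_def h_def)
  have "(\<Sum>y\<in>S. \<bar>pmf p y - pmf q y\<bar>) \<le> (\<Sum>y\<in>S. pmf p y + pmf q y)"
    by (rule sum_mono) (use pmf_nonneg[of p] pmf_nonneg[of q] in \<open>simp add: abs_le_iff add_increasing add_increasing2\<close>)
  also have "\<dots> = 2" using sum_pmf_eq_1[OF fin(1) pS] sum_pmf_eq_1[OF fin(1) qS] by (simp add: sum.distrib)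
  finally have "2 * sp * (\<Sum>y\<in>S. \<bar>pmf p y - pmf q y\<bar>) \<le> 2 * sp * 2" using sp by (intro mult_left_mono) auto
  thus "\<bar>drift d hist (x, a, y)\<bar> \<le> 4 * sp" using main by linarith
  define e where "e = (\<lambda>y. 4 * sqrt (emp_trans (past hist) x a y * (L / visits_plus (past hist) x a))
     + 28 * (L / visits_plus (past hist) x a))"
  have pe: "\<bar>pmf p y - emp_trans (past hist) x a y\<bar> \<le> e y" if "y \<in> S" for y
    using legal_feasible(2)[OF l f] x a h that
    by (simp add: conf_set_def conf_radius_def p_def e_def)
  have qe: "\<bar>pmf q y - emp_trans (past hist) x a y\<bar> \<le> e y" if "y \<in> S" for y
    using conf x a h that unfolding conf_set_def conf_radius_def q_def e_def mem_Collect_eq by blast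
  have "\<bar>pmf p y - pmf q y\<bar> \<le> 2 * e y" if "y \<in> S" for y
    using pe[OF that] qe[OF that] by linarith
  hence "(\<Sum>y\<in>S. \<bar>pmf p y - pmf q y\<bar>) \<le> (\<Sum>y\<in>S. 2 * e y)" by (intro sum_mono)
  also have "\<dots> = 2 * (\<Sum>y\<in>S. e y)" by (simp add: sum_distrib_left)
  also have "\<dots> \<le> 2 * (4 * sqrt (real (card S) * (L / visits_plus (past hist) x a)) +
      28 * real (card S) * (L / visits_plus (past hist) x a))"
    unfolding e_def by (rule mult_left_mono[OF l1_radius_sum[OF fin(1) L0]]) simp
  also have "L / visits_plus (past hist) x a = L * v" by (simp add: v_def)
  also have "sqrt (real (card S) * (L * v)) = sqrt (real (card S) * L) * sqrt v"
    by (simp add: real_sqrt_mult)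
  finally have "2 * sp * (\<Sum>y\<in>S. \<bar>pmf p y - pmf q y\<bar>) \<le>
      2 * sp * (2 * (4 * (sqrt (real (card S) * L) * sqrt v) + 28 * real (card S) * (L * v)))"
    using sp by (intro mult_left_mono) auto
  also have "\<dots> = 16 * sp * sqrt (real (card S) * L) * sqrt v + 112 * sp * real (card S) * L * v"
    by (simp add: algebra_simps)
  finally show "\<bar>drift d hist (x, a, y)\<bar> \<le> 16 * sp * sqrt (real (card S) * L) * sqrt v + 112 * sp * real (card S) * L * v"
    using main by linarith
qed

lemma log_bounds: "ln (real T + 1) \<le> L" "log 2 (real T) \<le> 2 * L" "0 \<le> log 2 (real T)"
proof -
  have "ln (real T + 1) \<le> ln (2 * real T)" using T by simp
  thus "ln (real T + 1) \<le> L" using L_ge(2) by linarith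
  have "ln (real T) \<le> ln (2 * real T)" using T by simp
  hence lT: "ln (real T) \<le> L" using L_ge(2) by linarith
  have "ln (real T) * (1 / 2) \<le> ln (real T) * ln 2"
    using T half_le_ln2 by (intro mult_left_mono) auto
  hence "log 2 (real T) \<le> 2 * ln (real T)" by (simp add: log_def divide_le_eq)
  thus "log 2 (real T) \<le> 2 * L" using lT by linarith
  show "0 \<le> log 2 (real T)" using T by simp
qed

section \<open>Deterministic bounds on runs inside all confidence sets\<close>

definition good :: "('s, 'a) history \<Rightarrow> bool" where
  "good \<omega> \<longleftrightarrow> \<omega> \<in> set_pmf R \<and> (\<forall>t<T. (\<lambda>x a h. trans M x a) \<in> conf_set M T H \<delta> (take t \<omega>))"

lemma good_run:
  assumes "good \<omega>"
  shows "length \<omega> = T" "set \<omega> \<subseteq> S \<times> A \<times> S"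
    and "i < T \<Longrightarrow> legal (take i \<omega>)" "i < T \<Longrightarrow> past (take i \<omega>) = take (i div H * H) \<omega>"
    and "i < T \<Longrightarrow> (\<lambda>x a h. trans M x a) \<in> conf_set M T H \<delta> (past (take i \<omega>))"
    and "i < T \<Longrightarrow> feasible (take i \<omega>)"
    and "i < T \<Longrightarrow> fst (\<omega> ! i) = cur_state s1 (take i \<omega>)"
    and "i < T \<Longrightarrow> \<omega> ! i \<in> S \<times> A \<times> S"
proof -
  have w: "\<omega> \<in> set_pmf R" using assms by (simp add: good_def)
  show len: "length \<omega> = T" by (rule length_rollout[OF w])
  show set: "set \<omega> \<subseteq> S \<times> A \<times> S" by (rule legal_rollout[OF w]) simp
  show legal: "legal (take i \<omega>)" if "i < T" for i
    using set set_take_subset[of i \<omega>] that len unfolding legal_def by auto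
  show past: "past (take i \<omega>) = take (i div H * H) \<omega>" if "i < T" for i
    using that len by (simp add: past_def min_def)
  show conf: "(\<lambda>x a h. trans M x a) \<in> conf_set M T H \<delta> (past (take i \<omega>))" if "i < T" for i
  proof -
    have "i div H * H < T" using that by (meson div_times_less_eq_dividend le_less_trans)
    thus ?thesis using assms unfolding past[OF that] good_def by blast
  qed
  show "feasible (take i \<omega>)" if "i < T"
    by (rule optimism(1)[OF legal[OF that] conf[OF that]])
  show "fst (\<omega> ! i) = cur_state s1 (take i \<omega>)" if "i < T"
    by (rule state_rollout[OF w that])
  show "\<omega> ! i \<in> S \<times> A \<times> S" if "i < T" using set that len nth_mem by blast
qed

lemma card_SA_bounds:
  "real (card (S \<times> A)) * real H \<le> real K" "(real (card S))\<^sup>2 * real (card A) \<le> real K" "sqrt (real T) \<le> real K"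
proof -
  have S1: "1 \<le> card S" and A1: "1 \<le> card A" and H1: "1 \<le> H" using card_pos H_pos by auto
  have "card (S \<times> A) * H \<le> card S * (card (S \<times> A) * H)" using S1 by simp
  also have "\<dots> = K" unfolding K_card by (simp add: card_cartesian_product power2_eq_square)
  finally show "real (card (S \<times> A)) * real H \<le> real K" by (simp only: of_nat_mult[symmetric] of_nat_le_iff)
  have "(card S)\<^sup>2 * card A \<le> H * ((card S)\<^sup>2 * card A)" using H1 by simp
  also have "\<dots> = K" unfolding K_card by simp
  finally have "real ((card S)\<^sup>2 * card A) \<le> real K" by (simp only: of_nat_le_iff)
  thus "(real (card S))\<^sup>2 * real (card A) \<le> real K" by simp
  have "H \<le> K" unfolding K_card using S1 A1 by simp
  hence "T \<le> K * K" unfolding KH[symmetric] by simp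
  hence "real T \<le> (real K)\<^sup>2" by (metis of_nat_le_iff of_nat_mult power2_eq_square)
  thus "sqrt (real T) \<le> real K" by (simp add: real_le_lsqrt)
qed

lemma drift_sum:
  assumes u: "utility d sp" and g: "good \<omega>"
  shows "(\<Sum>i<T. \<bar>drift d (take i \<omega>) (\<omega> ! i)\<bar>) \<le> 784 * L\<^sup>2 * (sp * real K)"
proof -
  let ?z = "\<lambda>i. (fst (\<omega> ! i), fst (snd (\<omega> ! i)))"
  define W where "W = 6 * real (card (S \<times> A)) * ln (real (K * H) + 1)"
  note r = good_run[OF g]
  have sp: "0 \<le> sp" by (rule utility_nonneg[OF u])
  have L: "1 / 2 \<le> L" by (rule L_ge)
  have Xin: "?z i \<in> S \<times> A" if "i < K * H" for i using r(8)[of i] that KH by (auto simp: mem_Times_iff)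
  have dr: "\<bar>drift d (take i \<omega>) (\<omega> ! i)\<bar> \<le> 4 * sp"
    "\<bar>drift d (take i \<omega>) (\<omega> ! i)\<bar> \<le> 16 * sp * sqrt (real (card S) * L) * sqrt (1 / real (max 1 (occurrences ?z (?z i) (i div H * H))))
       + 112 * sp * real (card S) * L * (1 / real (max 1 (occurrences ?z (?z i) (i div H * H))))"
    if i: "i < K * H" for i
  proof -
    have iT: "i < T" using i KH by simp
    obtain x a y where z: "\<omega> ! i = (x, a, y)" by (cases "\<omega> ! i") auto
    hence xa: "x \<in> S" "a \<in> A" using r(8)[OF iT] by auto
    have "i div H * H \<le> length \<omega>" using iT r(1) by (meson div_times_less_eq_dividend le_less_trans less_imp_le)
    hence v: "visits_plus (past (take i \<omega>)) x a = real (max 1 (occurrences ?z (?z i) (i div H * H)))"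
      unfolding visits_plus_def r(4)[OF iT] by (simp add: visits_take_eq_occurrences z)
    note b = drift_bounds[OF u r(3)[OF iT] r(6)[OF iT] r(5)[OF iT] xa, of y]
    show "\<bar>drift d (take i \<omega>) (\<omega> ! i)\<bar> \<le> 4 * sp" using b(1) by (simp add: z)
    show "\<bar>drift d (take i \<omega>) (\<omega> ! i)\<bar> \<le> 16 * sp * sqrt (real (card S) * L) * sqrt (1 / real (max 1 (occurrences ?z (?z i) (i div H * H))))
       + 112 * sp * real (card S) * L * (1 / real (max 1 (occurrences ?z (?z i) (i div H * H))))"
      using b(2) unfolding v z .
  qed
  have "(\<Sum>i<K * H. \<bar>drift d (take i \<omega>) (\<omega> ! i)\<bar>) \<le>
      4 * sp * (real (card (S \<times> A)) * real H * log 2 (real (K * H)))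
      + 16 * sp * sqrt (real (card S) * L) * sqrt (real (K * H) * W) + 112 * sp * real (card S) * L * W"
    unfolding W_def
  proof (rule sum_stale_rate_le[where z = ?z])
    show "finite (S \<times> A)" using fin by simp
    show "0 < K * H" using KH T by simp
  qed (use Xin dr sp L in auto)
  hence main: "(\<Sum>i<T. \<bar>drift d (take i \<omega>) (\<omega> ! i)\<bar>) \<le>
      4 * sp * (real (card (S \<times> A)) * real H * log 2 (real T))
      + 16 * sp * sqrt (real (card S) * L) * sqrt (real T * W) + 112 * sp * real (card S) * L * W"
    unfolding KH .
  have W: "W \<le> 6 * real (card (S \<times> A)) * L"
    unfolding W_def KH using log_bounds(1) by (intro mult_left_mono) auto
  have t1: "4 * sp * (real (card (S \<times> A)) * real H * log 2 (real T)) \<le> 8 * L * (sp * real K)"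
  proof -
    have "real (card (S \<times> A)) * real H * log 2 (real T) \<le> real K * (2 * L)"
      by (rule mult_mono[OF card_SA_bounds(1) log_bounds(2)]) (use log_bounds(3) in auto)
    hence "4 * sp * (real (card (S \<times> A)) * real H * log 2 (real T)) \<le> 4 * sp * (real K * (2 * L))"
      using sp by (intro mult_left_mono) auto
    thus ?thesis by (simp add: ac_simps)
  qed
  have t2: "16 * sp * sqrt (real (card S) * L) * sqrt (real T * W) \<le> 48 * L * (sp * real K)"
  proof -
    have "real (card S) * L * (real T * W) \<le> real (card S) * L * (real T * (6 * real (card (S \<times> A)) * L))"
      using L W by (intro mult_left_mono) auto
    also have "\<dots> = 6 * (L\<^sup>2 * (real (card S) * real (card S) * real (card A) * real T))"
      by (simp add: power2_eq_square card_cartesian_product ac_simps)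
    \<comment> \<open>One factor \<open>S\<close> stems from the radius, \<open>S A\<close> from the
      number of pairs and \<open>T\<close> from Cauchy-Schwarz; their product is exactly
      \<open>K^2\<close>.\<close>
    also have "real (card S) * real (card S) * real (card A) * real T = (real K)\<^sup>2"
      unfolding K_rate by (simp add: power_mult_distrib) (simp add: power2_eq_square)
    \<comment> \<open>Rounding 6 up to 9 makes the bound a perfect square.\<close>
    also have "6 * (L\<^sup>2 * (real K)\<^sup>2) \<le> 9 * (L\<^sup>2 * (real K)\<^sup>2)" by simp
    also have "\<dots> = (3 * L * real K)\<^sup>2" by (simp add: power_mult_distrib)
    finally have "sqrt (real (card S) * L * (real T * W)) \<le> 3 * L * real K"
      using L by (intro real_le_lsqrt) auto
    hence "16 * sp * sqrt (real (card S) * L * (real T * W)) \<le> 16 * sp * (3 * L * real K)"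
      using sp by (intro mult_left_mono) auto
    thus ?thesis by (simp add: real_sqrt_mult ac_simps)
  qed
  have t3: "112 * sp * real (card S) * L * W \<le> 672 * L\<^sup>2 * (sp * real K)"
  proof -
    have "112 * sp * real (card S) * L * W \<le> 112 * sp * real (card S) * L * (6 * real (card (S \<times> A)) * L)"
      using sp L W by (intro mult_left_mono) auto
    also have "\<dots> = 672 * L\<^sup>2 * sp * ((real (card S))\<^sup>2 * real (card A))"
      by (simp add: power2_eq_square card_cartesian_product ac_simps)
    also have "\<dots> \<le> 672 * L\<^sup>2 * sp * real K"
      using sp L card_SA_bounds(2) by (intro mult_left_mono) auto
    finally show ?thesis by (simp add: ac_simps)
  qed
  \<comment> \<open>\<open>t1\<close> and \<open>t2\<close> add up to \<open>56 L\<close>, at most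
    \<open>112 L^2\<close> since \<open>L \<ge> 1 / 2\<close>; with the 672 of \<open>t3\<close>
    this gives 784.\<close>
  have "L * 1 \<le> L * (2 * L)" using L by (intro mult_left_mono) auto
  hence "56 * L * (sp * real K) \<le> 112 * L\<^sup>2 * (sp * real K)"
    using sp by (intro mult_right_mono) (auto simp: power2_eq_square)
  thus ?thesis using main t1 t2 t3 by (simp add: algebra_simps)
qed

text \<open>
  Within an episode the Bellman equation makes utility, noise and drift telescope to the value
  at its first state.
\<close>

lemma episode_sum:
  assumes g: "good \<omega>" and k: "k < K"
  shows "(\<Sum>i\<in>{k * H..<k * H + H}. d (fst (\<omega> ! i)) (fst (snd (\<omega> ! i))) +
      noise d (take i \<omega>) (\<omega> ! i) + drift d (take i \<omega>) (\<omega> ! i)) =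
    Val d (take (k * H) \<omega>) 1 (start (take (k * H) \<omega>))"
proof -
  note r = good_run[OF g]
  \<comment> \<open>The planned value after \<open>j\<close> steps of the episode has step index
    \<open>j + 1\<close>; hence \<open>W H\<close> is the terminal value 0.\<close>
  define W where "W = (\<lambda>j. Val d (take (k * H) \<omega>) (j + 1) (cur_state s1 (take (k * H + j) \<omega>)))"
  have "k * H + H = Suc k * H" by simp
  also have "\<dots> \<le> K * H" using k by (intro mult_le_mono1) simp
  finally have kT: "k * H + H \<le> T" using KH by simp
  have step: "d (fst (\<omega> ! (k * H + j))) (fst (snd (\<omega> ! (k * H + j)))) +
      noise d (take (k * H + j) \<omega>) (\<omega> ! (k * H + j)) + drift d (take (k * H + j) \<omega>) (\<omega> ! (k * H + j)) =
      W j - W (Suc j)" if j: "j < H" for j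
  proof -
    let ?i = "k * H + j"
    have iT: "?i < T" and kT': "k * H < T" using j kT by auto
    obtain x a y where z: "\<omega> ! ?i = (x, a, y)" by (cases "\<omega> ! ?i") auto
    have dm: "?i div H = k" "?i mod H = j" using j by auto
    \<comment> \<open>Truncation to completed episodes gives the same history throughout the
      episode, so a single plan and value function are in force.\<close>
    have "past (take ?i \<omega>) = past (take (k * H) \<omega>)"
      unfolding r(4)[OF iT] r(4)[OF kT'] dm using H_pos by simp
    hence V: "Val d (take ?i \<omega>) = Val d (take (k * H) \<omega>)"
      by (intro ext) (simp add: Val_def pol_of_def ker_of_def start_def)
    have st: "step_of (take ?i \<omega>) = j + 1"
      using dm iT r(1) by (simp add: step_of_def min_def)
    have x: "x = cur_state s1 (take ?i \<omega>)" using r(7)[OF iT] z by simp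
    have y: "y = cur_state s1 (take (Suc ?i) \<omega>)" using cur_state_take_Suc[of ?i \<omega> s1] iT r(1) z by simp
    show ?thesis
      unfolding z W_def noise_def using r(6)[OF iT]
      by (simp add: st V x[symmetric] y[symmetric])
  qed
  have "(\<Sum>i\<in>{k * H..<k * H + H}. d (fst (\<omega> ! i)) (fst (snd (\<omega> ! i))) +
      noise d (take i \<omega>) (\<omega> ! i) + drift d (take i \<omega>) (\<omega> ! i)) =
    (\<Sum>j<H. d (fst (\<omega> ! (k * H + j))) (fst (snd (\<omega> ! (k * H + j)))) +
      noise d (take (k * H + j) \<omega>) (\<omega> ! (k * H + j)) + drift d (take (k * H + j) \<omega>) (\<omega> ! (k * H + j)))"
    by (simp add: sum.atLeastLessThan_shift_0[of _ "k * H"] atLeast0LessThan)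
  also have "\<dots> = (\<Sum>j<H. W j - W (Suc j))"
    by (intro sum.cong refl step) simp
  also have "\<dots> = W 0 - W H" by (rule sum_lessThan_telescope')
  also have "W H = 0" by (simp add: W_def Val_def)
  also have "W 0 - 0 = Val d (take (k * H) \<omega>) 1 (start (take (k * H) \<omega>))"
  proof -
    have "k * H < T" using kT H_pos by simp
    from r(4)[OF this] have "past (take (k * H) \<omega>) = take (k * H) \<omega>" using H_pos by simp
    thus ?thesis by (simp add: W_def start_def)
  qed
  finally show ?thesis .
qed

lemma run_sum:
  assumes g: "good \<omega>"
  shows "(\<Sum>i<T. d (fst (\<omega> ! i)) (fst (snd (\<omega> ! i)))) =
    (\<Sum>k<K. Val d (take (k * H) \<omega>) 1 (start (take (k * H) \<omega>)))
    - (\<Sum>i<T. noise d (take i \<omega>) (\<omega> ! i)) - (\<Sum>i<T. drift d (take i \<omega>) (\<omega> ! i))"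
proof -
  have "(\<Sum>k<K. Val d (take (k * H) \<omega>) 1 (start (take (k * H) \<omega>))) =
    (\<Sum>i<K * H. d (fst (\<omega> ! i)) (fst (snd (\<omega> ! i))) +
      noise d (take i \<omega>) (\<omega> ! i) + drift d (take i \<omega>) (\<omega> ! i))"
    unfolding sum.nat_group[symmetric] using episode_sum[OF g] by simp
  thus ?thesis unfolding KH by (simp add: sum.distrib)
qed

lemma rate_bounds:
  assumes "0 \<le> sp"
  shows "sqrt (real T) \<le> span_rate M T sp" "sp * real K \<le> span_rate M T sp"
  unfolding span_rate_def K_rate by (simp_all add: ac_simps)

text \<open>The constant is 784 from the drift, 20 from the noise and 4 from the loss of one span
  per episode. In the noise, \<open>sp sqrt T\<close> is at most \<open>sp K\<close>, and the
  remaining \<open>sqrt T\<close> is what the floor of \<open>span_rate\<close> is for.\<close>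

lemma deviation_total:
  assumes u: "utility d sp" and g: "good \<omega>" and \<sigma>: "\<sigma> \<in> {1, -1 :: real}"
    and n: "(\<Sum>i<T. \<sigma> * noise d (take i \<omega>) (\<omega> ! i)) \<le> (1 + 4 * sp) * sqrt (real T) * (1 / 2 + L)"
  shows "real K * sp + \<sigma> * ((\<Sum>i<T. noise d (take i \<omega>) (\<omega> ! i)) + (\<Sum>i<T. drift d (take i \<omega>) (\<omega> ! i)))
    \<le> 808 * L\<^sup>2 * span_rate M T sp"
proof -
  define \<rho> where "\<rho> = span_rate M T sp"
  have sp: "0 \<le> sp" by (rule utility_nonneg[OF u])
  have L: "1 / 2 \<le> L" by (rule L_ge)
  note rho = rate_bounds[OF sp, folded \<rho>_def]
  have rho0: "0 \<le> \<rho>" using rho(1) by (rule order_trans[rotated]) simp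
  have "sp * sqrt (real T) \<le> sp * real K" using sp card_SA_bounds(3) by (intro mult_left_mono) auto
  hence b: "(1 + 4 * sp) * sqrt (real T) \<le> 5 * \<rho>"
    using rho by (simp add: distrib_right)
  have LL: "1 \<le> 4 * L\<^sup>2" "L \<le> 2 * L\<^sup>2"
  proof -
    have "(1 / 2)\<^sup>2 \<le> L\<^sup>2" using L by (intro power_mono) auto
    thus "1 \<le> 4 * L\<^sup>2" by (simp add: power2_eq_square)
    have "L * 1 \<le> L * (2 * L)" using L by (intro mult_left_mono) auto
    thus "L \<le> 2 * L\<^sup>2" by (simp add: power2_eq_square)
  qed
  have "(1 + 4 * sp) * sqrt (real T) * (1 / 2 + L) \<le> 5 * \<rho> * (4 * L\<^sup>2)"
    by (rule mult_mono[OF b]) (use rho0 L LL in linarith)+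
  moreover have "real K * sp \<le> 4 * L\<^sup>2 * \<rho>"
    using mult_mono[OF LL(1) rho(2)] sp by (simp add: mult.commute)
  moreover have "\<sigma> * (\<Sum>i<T. drift d (take i \<omega>) (\<omega> ! i)) \<le> (\<Sum>i<T. \<bar>drift d (take i \<omega>) (\<omega> ! i)\<bar>)"
    using \<sigma> sum_abs[of "\<lambda>i. drift d (take i \<omega>) (\<omega> ! i)" "{..<T}"] by (auto simp: abs_le_iff)
  moreover have "784 * L\<^sup>2 * (sp * real K) \<le> 784 * L\<^sup>2 * \<rho>"
    using rho(2) by (intro mult_left_mono) auto
  moreover have "5 * \<rho> * (4 * L\<^sup>2) = 20 * (L\<^sup>2 * \<rho>)" "4 * L\<^sup>2 * \<rho> = 4 * (L\<^sup>2 * \<rho>)"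
    "784 * L\<^sup>2 * \<rho> = 784 * (L\<^sup>2 * \<rho>)" "808 * L\<^sup>2 * \<rho> = 808 * (L\<^sup>2 * \<rho>)"
    by simp_all
  ultimately show ?thesis
    using drift_sum[OF u g] n
    unfolding \<rho>_def[symmetric] distrib_left[of \<sigma>] sum_distrib_left[symmetric, of \<sigma>] by linarith
qed

section \<open>Regret, violation and the failure probability\<close>

lemma regret_eq: "regret M Jr \<omega> = real (length \<omega>) * Jr - (\<Sum>i<length \<omega>. reward M (fst (\<omega> ! i)) (fst (snd (\<omega> ! i))))"
  unfolding regret_def
  by (simp add: sum_list_sum_nth atLeast0LessThan case_prod_beta sum_subtractf)

lemma violation_eq: "violation M \<omega> = (\<Sum>i<length \<omega>. cost M (fst (\<omega> ! i)) (fst (snd (\<omega> ! i)))) - real (length \<omega>) * threshold M"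
  unfolding violation_def
  by (simp add: sum_list_sum_nth atLeast0LessThan case_prod_beta sum_subtractf)

text \<open>Realized reward is planned value minus noise and drift, so both enter the regret with
  sign 1; optimism accounts for \<open>K spr\<close>.\<close>

lemma good_regret:
  assumes g: "good \<omega>"
    and n: "(\<Sum>i<T. 1 * noise (reward M) (take i \<omega>) (\<omega> ! i)) \<le> (1 + 4 * spr) * sqrt (real T) * (1 / 2 + L)"
  shows "regret M Jr \<omega> \<le> 808 * L\<^sup>2 * span_rate M T spr"
proof -
  note r = good_run[OF g]
  have u: "utility (reward M) spr" by (simp add: utility_def)
  have "(\<Sum>k<K. real H * Jr - spr) \<le> (\<Sum>k<K. Val (reward M) (take (k * H) \<omega>) 1 (start (take (k * H) \<omega>)))"
  proof (rule sum_mono)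
    fix k assume "k \<in> {..<K}"
    hence kT: "k * H < T" using KH H_pos by (metis lessThan_iff mult_less_mono1)
    show "real H * Jr - spr \<le> Val (reward M) (take (k * H) \<omega>) 1 (start (take (k * H) \<omega>))"
      by (rule optimism(2)[OF r(3,5)[OF kT]])
  qed
  moreover have "(\<Sum>k<K. real H * Jr - spr) = real T * Jr - real K * spr"
    using KH by (simp add: right_diff_distrib flip: KH)
  ultimately show ?thesis
    using deviation_total[OF u g _ n] run_sum[OF g, of "reward M"] r(1)
    by (simp add: regret_eq)
qed

text \<open>The cost constraint bounds each planned value from above, with total slack
  \<open>K spc\<close>. An upper bound on the realized cost is wanted, so noise and drift enter with
  sign -1.\<close>

lemma good_violation:
  assumes g: "good \<omega>"
    and n: "(\<Sum>i<T. - 1 * noise (cost M) (take i \<omega>) (\<omega> ! i)) \<le> (1 + 4 * spc) * sqrt (real T) * (1 / 2 + L)"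
  shows "violation M \<omega> \<le> 808 * L\<^sup>2 * span_rate M T spc"
proof -
  note r = good_run[OF g]
  have u: "utility (cost M) spc" by (simp add: utility_def)
  have "(\<Sum>k<K. Val (cost M) (take (k * H) \<omega>) 1 (start (take (k * H) \<omega>))) \<le> (\<Sum>k<K. real H * threshold M + spc)"
  proof (rule sum_mono)
    fix k assume "k \<in> {..<K}"
    hence kT: "k * H < T" using KH H_pos by (metis lessThan_iff mult_less_mono1)
    show "Val (cost M) (take (k * H) \<omega>) 1 (start (take (k * H) \<omega>)) \<le> real H * threshold M + spc"
      using legal_feasible(3,4)[OF r(3)[OF kT] r(6)[OF kT]] by metis
  qed
  moreover have "(\<Sum>k<K. real H * threshold M + spc) = real T * threshold M + real K * spc"
    using KH by (simp add: distrib_left flip: KH)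
  ultimately show ?thesis
    using deviation_total[OF u g _ n] run_sum[OF g, of "cost M"] r(1)
    by (simp add: violation_eq)
qed

text \<open>There are three failure events of probability at most \<open>\<delta>\<close> each: the
  confidence sets, the reward noise and the cost noise. Outside them the bounds are
  deterministic.\<close>

lemma prob_bounds:
  "measure_pmf.prob (learner_run M T H plan s1)
     {\<omega>. regret M Jr \<omega> \<le> 808 * L\<^sup>2 * span_rate M T spr \<and>
         violation M \<omega> \<le> 808 * L\<^sup>2 * span_rate M T spc} \<ge> 1 - 6 * \<delta>"
proof -
  let ?E = "{\<omega>. regret M Jr \<omega> \<le> 808 * L\<^sup>2 * span_rate M T spr \<and>
         violation M \<omega> \<le> 808 * L\<^sup>2 * span_rate M T spc}"
  let ?B0 = "{\<omega>. \<not> (\<forall>t<T. (\<lambda>x a h. trans M x a) \<in> conf_set M T H \<delta> (take t \<omega>))}"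
  let ?B1 = "{\<omega>. (1 + 4 * spr) * sqrt (real T) * (1 / 2 + L) < (\<Sum>i<T. 1 * noise (reward M) (take i \<omega>) (\<omega> ! i))}"
  let ?B2 = "{\<omega>. (1 + 4 * spc) * sqrt (real T) * (1 / 2 + L) < (\<Sum>i<T. - 1 * noise (cost M) (take i \<omega>) (\<omega> ! i))}"
  have "measure_pmf.prob R (- ?E) = measure_pmf.prob R (- ?E \<inter> set_pmf R)"
    by (rule measure_Int_set_pmf[symmetric])
  also have "\<dots> \<le> measure_pmf.prob R (?B0 \<union> ?B1 \<union> ?B2)"
  proof (rule measure_pmf.finite_measure_mono)
    show "- ?E \<inter> set_pmf R \<subseteq> ?B0 \<union> ?B1 \<union> ?B2"
    proof
      fix \<omega> assume w: "\<omega> \<in> - ?E \<inter> set_pmf R"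
      show "\<omega> \<in> ?B0 \<union> ?B1 \<union> ?B2"
      proof (rule ccontr)
        assume n: "\<omega> \<notin> ?B0 \<union> ?B1 \<union> ?B2"
        hence "good \<omega>" using w unfolding good_def by blast
        moreover have "(\<Sum>i<T. 1 * noise (reward M) (take i \<omega>) (\<omega> ! i)) \<le> (1 + 4 * spr) * sqrt (real T) * (1 / 2 + L)"
          "(\<Sum>i<T. - 1 * noise (cost M) (take i \<omega>) (\<omega> ! i)) \<le> (1 + 4 * spc) * sqrt (real T) * (1 / 2 + L)"
          using n by (simp_all only: Un_iff mem_Collect_eq not_less de_Morgan_disj)
        ultimately show False using good_regret good_violation w by blast
      qed
    qed
  qed simp
  also have "\<dots> \<le> measure_pmf.prob R ?B0 + measure_pmf.prob R ?B1 + measure_pmf.prob R ?B2"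
    by (intro order_trans[OF measure_Un_le] add_right_mono) auto
  also have "\<dots> \<le> \<delta> + \<delta> + \<delta>"
    by (intro add_mono prob_conf_set[OF M \<delta> T] noise_tail) (auto simp: utility_def)
  finally have "measure_pmf.prob R (- ?E) \<le> 3 * \<delta>" by simp
  moreover have "measure_pmf.prob R (- ?E) = 1 - measure_pmf.prob R ?E"
    using measure_pmf.prob_compl[of ?E R] by (simp add: Compl_eq_Diff_UNIV)
  ultimately show ?thesis using \<delta>(1) unfolding learner_run_def by linarith
qed

end

theorem theorem3:
  shows "\<exists>(C::real) (p::nat).
    \<forall>(M :: (nat, nat) cmdp) \<pi>s Jr Jc qr qc spr spc (\<delta>::real) (T::nat) (H::nat) (K::nat) plan s1.
      cmdp M \<and> weakly_communicating M \<and>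
      optimal_policy M \<pi>s Jr Jc \<and>
      is_bias M \<pi>s (reward M) qr \<and> spr = span_on (states M) (policy_avg M \<pi>s qr) \<and>
      is_bias M \<pi>s (cost M) qc \<and> spc = span_on (states M) (policy_avg M \<pi>s qc) \<and>
      0 < \<delta> \<and> \<delta> < 1 \<and> 0 < T \<and>
      real H = sqrt (real T / (real (card (states M)) ^ 2 * real (card (actions M)))) \<and>
      real K = real T / real H \<and>
      valid_planner M T H K \<delta> spr spc plan \<and>
      s1 \<in> states M
      \<longrightarrow>
      measure_pmf.prob (learner_run M T H plan s1)
        {\<omega>. regret M Jr \<omega> \<le> C * log_term M T \<delta> ^ p * span_rate M T spr \<and>
            violation M \<omega> \<le> C * log_term M T \<delta> ^ p * span_rate M T spc}
      \<ge> 1 - 6 * \<delta>"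
proof (rule exI[of _ 808], rule exI[of _ 2], intro allI impI, elim conjE)
  fix M :: "(nat, nat) cmdp" and \<pi>s Jr Jc qr qc spr spc and \<delta> :: real and T H K plan s1
  assume "cmdp M" "optimal_policy M \<pi>s Jr Jc"
    "is_bias M \<pi>s (reward M) qr" "spr = span_on (states M) (policy_avg M \<pi>s qr)"
    "is_bias M \<pi>s (cost M) qc" "spc = span_on (states M) (policy_avg M \<pi>s qc)"
    "0 < \<delta>" "\<delta> < 1" "0 < T"
    "real H = sqrt (real T / (real (card (states M)) ^ 2 * real (card (actions M))))"
    "real K = real T / real H"
    "valid_planner M T H K \<delta> spr spc plan" "s1 \<in> states M"
  then interpret cmdp_learning M \<pi>s Jr Jc qr qc spr spc \<delta> T H K plan s1
    by unfold_locales
  show "1 - 6 * \<delta> \<le> measure_pmf.prob (learner_run M T H plan s1)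
        {\<omega>. regret M Jr \<omega> \<le> 808 * log_term M T \<delta> ^ 2 * span_rate M T spr \<and>
            violation M \<omega> \<le> 808 * log_term M T \<delta> ^ 2 * span_rate M T spc}"
    by (rule prob_bounds)
qed

end
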